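(* For every integer $n\ge 6$, the maximum number of triples in a triple system on $n$ vertices that contains no Berge-$K_4$ is $$\mathrm{ex}_3(n,\mathcal{B})=f(n)=\left\lfloor\frac{n}{3}\right\rfloor\left\lfloor\frac{n+1}{3}\right\rfloor\left\lfloor\frac{n+2}{3}\right\rfloor,$$ which equals the number of triples of the balanced complete $3$-partite triple system on $n$ vertices (all triples $\{a,b,c\}$ with $a\in A,b\in B,c\in C$ for a partition $A,B,C$ of the $n$ vertices with $\lfloor n/3\rfloor=|A|\le|B|\le|C|=\lceil n/3\rceil$).
   Context: A triple system is a $3$-uniform hypergraph, i.e. a set $V$ of vertices together with a set of $3$-element subsets of $V$ (triples). A Berge-$K_4$ in a triple system is a configuration consisting of four distinct vertices $v_1,v_2,v_3,v_4$ and six distinct triples $e_{ij}$ ($1\le i<j\le 4$) of the system such that $\{v_i,v_j\}\subset e_{ij}$ for every $1\le i<j\le 4$. $\mathcal{B}$ denotes the family of all Berge-$K_4$ configurations. A triple system is $\mathcal{B}$-free if it contains no Berge-$K_4$. $\mathrm{ex}_3(n,\mathcal{F})$ denotes the maximum number of triples in a triple system on $n$ vertices containing no member of the family $\mathcal{F}$ as a subhypergraph. *)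

theory Defs
  imports Main
begin

definition triple_system :: "'a set \<Rightarrow> 'a set set \<Rightarrow> bool" where
  "triple_system V H \<longleftrightarrow> (\<forall>e\<in>H. e \<subseteq> V \<and> card e = 3)"

definition has_berge_K4 :: "'a set set \<Rightarrow> bool" where
  "has_berge_K4 H \<longleftrightarrow>
     (\<exists>(v :: nat \<Rightarrow> 'a) (e :: nat \<Rightarrow> nat \<Rightarrow> 'a set).
        inj_on v {1..4} \<and>
        inj_on (\<lambda>(i, j). e i j) {(i, j). 1 \<le> i \<and> i < j \<and> j \<le> 4} \<and>
        (\<forall>i j. 1 \<le> i \<and> i < j \<and> j \<le> 4 \<longrightarrow> e i j \<in> H \<and> {v i, v j} \<subseteq> e i j))"

definition B_free :: "'a set set \<Rightarrow> bool" where
  "B_free H \<longleftrightarrow> \<not> has_berge_K4 H"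

definition ex3_B :: "nat \<Rightarrow> nat" where
  "ex3_B n = Max {card H | H :: nat set set. triple_system {0..<n} H \<and> B_free H}"

definition f :: "nat \<Rightarrow> nat" where
  "f n = (n div 3) * ((n + 1) div 3) * ((n + 2) div 3)"

definition complete_3partite :: "'a set \<Rightarrow> 'a set \<Rightarrow> 'a set \<Rightarrow> 'a set set" where
  "complete_3partite A B C = {{a, b, c} | a b c. a \<in> A \<and> b \<in> B \<and> c \<in> C}"

end

(* A B-free triple system H on n >= 9 points is compared with a two-coloured graph. Let S be a set
   of triples maximizing |S| minus the number of pairs covered by S. By Hall's theorem the pairs
   covered by S (red) can be matched into S, and the triples outside S can be matched to further
   pairs (blue). A K_4 of red and blue pairs would be a Berge-K_4, so this graph is K_4-free, and
   |H| is at most the number of red triangles plus the number of blue edges. Let u be a vertex lying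
   in the most red triangles and blue edges, with p red neighbours, q blue neighbours and
   c = n - p - q non-neighbours. The neighbourhood of u is triangle-free, and Mantel's theorem gives
   the bound (c - 1)[p^2/4] + [(p + q)^2/4] + cq, which is convex in p for fixed p + q and hence at
   most the larger of f(n) and [n^2/3]; for n >= 9 this is f(n).

   For n = 6 an exhaustive search shows that eight triples form an octahedron K(2,2,2) or two
   complete systems on four points sharing a pair, and a ninth triple always creates a Berge-K_4.
   For n = 7 and n = 8 one deletes one or two vertices of small degree and looks at how their links
   attach to such a six-point system. For n = 8 this fails only if all pairs within some five
   points have codegree 2, and then any three of these five points form a triple, which is absurd. *)

theory Submission
  imports Defs
begin

subsection \<open>Building Berge configurations\<close>

text \<open>Both uses of Hall's theorem rest on the one maximality of S. If a set of red pairs met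
  too few triples of S, removing those triples would increase |S| minus the number of covered pairs;
  if a set of triples outside S had too few uncovered pairs, adding it would increase this
  difference. All pairs of a triple in S are red, which is why S is counted by red triangles and the
  remaining triples by blue edges. The restriction n >= 9 comes from the end p = 0 of the final
  estimate, where the vertex of maximum weight has only blue neighbours: there it gives [n^2/3],
  Turan's bound for K_4-free graphs. For n = 6, 7, 8 this is 12, 16, 21, but f(n) is 8, 12, 18, so
  the two-coloured graph has forgotten too much. These orders are climbed from six points instead. A
  vertex outside an octahedron has at most four link edges on it, and exactly four only if it is
  joined completely to two parts, like a further point of the third part. A vertex outside two
  complete systems sharing a pair has at most one.\<close>

lemma has_berge_K4I:
  assumes "distinct [a, b, c, d]" and "distinct [e12, e13, e14, e23, e24, e34]"
    and "e12 \<in> H" "e13 \<in> H" "e14 \<in> H" "e23 \<in> H" "e24 \<in> H" "e34 \<in> H"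
    and "{a, b} \<subseteq> e12" "{a, c} \<subseteq> e13" "{a, d} \<subseteq> e14" "{b, c} \<subseteq> e23" "{b, d} \<subseteq> e24" "{c, d} \<subseteq> e34"
  shows "has_berge_K4 H"
proof -
  define v where "v i = [a, b, c, d] ! (i - 1)" for i
  define e where "e i j = (if i = 1 then [e12, e13, e14] ! (j - 2)
    else if i = 2 then [e23, e24] ! (j - 3) else e34)" for i j :: nat
  have idx: "{(i, j). 1 \<le> i \<and> i < j \<and> j \<le> 4} = {(1, 2), (1, 3), (1, 4), (2, 3), (2, 4), (3, 4 :: nat)}"
    by auto
  have "{1..4} = {1, 2, 3, 4 :: nat}" by auto
  then have "inj_on v {1..4}" using assms(1) by (auto simp: v_def)
  moreover have "inj_on (\<lambda>(i, j). e i j) {(i, j). 1 \<le> i \<and> i < j \<and> j \<le> 4}"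
    unfolding idx using assms(2) by (auto simp: e_def)
  moreover have "\<forall>(i, j) \<in> {(i, j). 1 \<le> i \<and> i < j \<and> j \<le> 4}. e i j \<in> H \<and> {v i, v j} \<subseteq> e i j"
    unfolding idx using assms(3-) by (simp add: e_def v_def)
  ultimately show ?thesis unfolding has_berge_K4_def by blast
qed

text \<open>A triple cannot contain two disjoint pairs, and triples on two pairs with a common point
  coincide only if each third point is the outer end of the other pair. So distinctness of the six
  triples amounts to the last twelve conditions, one for each two adjacent edges of the
  core.\<close>

lemma has_berge_K4_thirdsI:
  assumes "distinct [a, b, c, d]"
    and "{a, b, x12} \<in> H" "{a, c, x13} \<in> H" "{a, d, x14} \<in> H"
      "{b, c, x23} \<in> H" "{b, d, x24} \<in> H" "{c, d, x34} \<in> H"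
    and "x12 \<notin> {a, b}" "x13 \<notin> {a, c}" "x14 \<notin> {a, d}" "x23 \<notin> {b, c}" "x24 \<notin> {b, d}" "x34 \<notin> {c, d}"
    and "\<not> (x12 = c \<and> x13 = b)" "\<not> (x12 = d \<and> x14 = b)" "\<not> (x13 = d \<and> x14 = c)"
      "\<not> (x12 = c \<and> x23 = a)" "\<not> (x12 = d \<and> x24 = a)" "\<not> (x23 = d \<and> x24 = c)"
      "\<not> (x13 = b \<and> x23 = a)" "\<not> (x13 = d \<and> x34 = a)" "\<not> (x23 = d \<and> x34 = b)"
      "\<not> (x14 = b \<and> x24 = a)" "\<not> (x14 = c \<and> x34 = a)" "\<not> (x24 = c \<and> x34 = b)"
  shows "has_berge_K4 H"
proof -
  have adj: "{p, q, x} \<noteq> {p, r, y}"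
    if "q \<noteq> r" "p \<noteq> q" "p \<noteq> r" "x \<notin> {p, q}" "y \<notin> {p, r}" "\<not> (x = r \<and> y = q)" for p q r x y :: 'a
  proof
    assume "{p, q, x} = {p, r, y}"
    then have "q \<in> {p, r, y}" "r \<in> {p, q, x}" by (metis insertI1 insertI2)+
    then show False using that by auto
  qed
  have opp: "{p, q, x} \<noteq> {r, s, y}"
    if "distinct [p, q, r, s]" "x \<notin> {p, q}" "y \<notin> {r, s}" for p q r s x y :: 'a
  proof
    assume "{p, q, x} = {r, s, y}"
    then have "p \<in> {r, s, y}" "q \<in> {r, s, y}" by (metis insertI1 insertI2)+
    then show False using that by auto
  qed
  have "b \<noteq> a" "c \<noteq> a" "d \<noteq> a" "c \<noteq> b" "d \<noteq> b" "d \<noteq> c"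
    using assms(1) by auto
  then have "distinct [{a, b, x12}, {a, c, x13}, {a, d, x14}, {b, c, x23}, {b, d, x24}, {c, d, x34}]"
    using assms(1,8-) adj[of b c a x12 x13] adj[of b d a x12 x14] adj[of c d a x13 x14]
      adj[of a c b x12 x23] adj[of a d b x12 x24] adj[of c d b x23 x24]
      adj[of a b c x13 x23] adj[of a d c x13 x34] adj[of b d c x23 x34]
      adj[of a b d x14 x24] adj[of a c d x14 x34] adj[of b c d x24 x34]
      opp[of a b c d x12 x34] opp[of a c b d x13 x24] opp[of a d b c x14 x23]
    by (simp add: insert_commute)
  then show ?thesis
    by (intro has_berge_K4I[OF assms(1) _ assms(2-7)]) simp_all
qed

lemma has_berge_K4_mono: "has_berge_K4 H \<Longrightarrow> H \<subseteq> H' \<Longrightarrow> has_berge_K4 H'"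
  unfolding has_berge_K4_def by (meson subsetD)

lemma B_free_subset: "B_free H' \<Longrightarrow> H \<subseteq> H' \<Longrightarrow> B_free H"
  using has_berge_K4_mono unfolding B_free_def by blast

lemma triple_system_subset: "triple_system V H' \<Longrightarrow> H \<subseteq> H' \<Longrightarrow> triple_system V H"
  unfolding triple_system_def by blast

lemma triple_system_finite:
  "triple_system V H \<Longrightarrow> finite V \<Longrightarrow> finite H"
  unfolding triple_system_def by (meson finite_Pow_iff finite_subset Pow_iff subsetI)

lemma triple_third:
  assumes "card e = 3" "{x, y} \<subseteq> e" "x \<noteq> y" obtains z where "e = {x, y, z}" "z \<notin> {x, y}"
proof -
  have "card (e - {x, y}) = 1" using assms by (simp add: card_Diff_subset)
  then obtain z where "e - {x, y} = {z}" by (auto simp: card_1_singleton_iff)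
  then have "e = {x, y, z}" "z \<notin> {x, y}" using assms(2) by auto
  then show thesis by (rule that)
qed

text \<open>The apex \<open>a\<close> is opposite to a missing triple \<open>{b, c, d}\<close>; the pairs at \<open>a\<close> use the three
  other triples of the four points cyclically whenever these are available.\<close>

lemma has_berge_K4_if_codegrees:
  assumes H: "triple_system V H" and dist: "distinct [a, b, c, d]" and missing: "{b, c, d} \<notin> H"
    and cod: "\<And>x y. x \<in> {a, b, c, d} \<Longrightarrow> y \<in> {a, b, c, d} \<Longrightarrow> x \<noteq> y \<Longrightarrow> 2 \<le> card {e \<in> H. {x, y} \<subseteq> e}"
  shows "has_berge_K4 H"
proof -
  have third: "\<exists>z. {x, y, z} \<in> H \<and> z \<notin> {x, y, w}"
    if xy: "x \<in> {a, b, c, d}" "y \<in> {a, b, c, d}" "x \<noteq> y" for x y w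
  proof -
    \<comment> \<open>Codegree two leaves a triple after any single one has been forbidden.\<close>
    have "\<exists>e \<in> {e \<in> H. {x, y} \<subseteq> e}. e \<noteq> {x, y, w}"
    proof (rule ccontr)
      assume "\<not> ?thesis"
      then have sub: "{e \<in> H. {x, y} \<subseteq> e} \<subseteq> {{x, y, w}}" by blast
      have "card {e \<in> H. {x, y} \<subseteq> e} \<le> 1" using card_mono[OF _ sub] by simp
      then show False using cod[OF that] by simp
    qed
    then obtain e where e: "e \<in> H" "{x, y} \<subseteq> e" "e \<noteq> {x, y, w}" by blast
    have "card e = 3" using H e(1) by (simp add: triple_system_def)
    then obtain z where "e = {x, y, z}" "z \<notin> {x, y}" using triple_third[OF _ e(2) xy(3)] by blast
    then show ?thesis using e by auto
  qed
  obtain x12 where 12: "{a, b, x12} \<in> H" "x12 \<notin> {a, b, d}" using third[of a b d] dist by auto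
  obtain x13 where 13: "{a, c, x13} \<in> H" "x13 \<notin> {a, c, b}" using third[of a c b] dist by auto
  obtain x14 where 14: "{a, d, x14} \<in> H" "x14 \<notin> {a, d, c}" using third[of a d c] dist by auto
  obtain x23 where 23: "{b, c, x23} \<in> H" "x23 \<notin> {b, c, a}" using third[of b c a] dist by auto
  obtain x24 where 24: "{b, d, x24} \<in> H" "x24 \<notin> {b, d, a}" using third[of b d a] dist by auto
  obtain x34 where 34: "{c, d, x34} \<in> H" "x34 \<notin> {c, d, a}" using third[of c d a] dist by auto
  \<comment> \<open>The pairs avoiding \<open>a\<close> have already been kept away from
    \<open>a\<close>; the missing triple now pushes their third points outside the four
    points.\<close>
  have "x23 \<noteq> d" "x24 \<noteq> c" "x34 \<noteq> b" using 23 24 34 missing by (auto simp: insert_commute)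
  then show ?thesis
    by (intro has_berge_K4_thirdsI[OF dist 12(1) 13(1) 14(1) 23(1) 24(1) 34(1)])
      (use 12 13 14 23 24 34 in auto)
qed

section \<open>Berge configurations around the two six-point systems\<close>

lemma complete_3partiteI: "a \<in> A \<Longrightarrow> b \<in> B \<Longrightarrow> c \<in> C \<Longrightarrow> {a, b, c} \<in> complete_3partite A B C"
  unfolding complete_3partite_def by blast

lemma complete_3partite_rotate: "complete_3partite A B C = complete_3partite B C A"
  unfolding complete_3partite_def by (auto simp: insert_commute)

lemma complete_3partite_swap: "complete_3partite A B C = complete_3partite A C B"
  unfolding complete_3partite_def by (auto simp: insert_commute)

text \<open>Take the core \<open>a, a', b, c\<close>. The octahedron covers each pair other than the
  three parts twice, so third points \<open>b'\<close> and \<open>c'\<close> serve the pairs at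
  \<open>a\<close> and \<open>a'\<close>; \<open>e\<close> supplies the one core pair that is a
  part.\<close>

lemma octahedron_part_pair:
  assumes oct: "complete_3partite {a, a'} {b, b'} {c, c'} \<subseteq> H"
    and dist: "distinct [a, a', b, b', c, c']"
    and e: "e \<in> H" "card e = 3" "{a, a'} \<subseteq> e"
  shows "has_berge_K4 H"
proof -
  obtain x where x: "e = {a, a', x}" "x \<notin> {a, a'}"
    using triple_third[OF e(2,3)] dist by auto
  have "{a, b, c'} \<in> H" "{a, c, b'} \<in> H" "{a', b, c'} \<in> H" "{a', c, b'} \<in> H" "{b, c, a} \<in> H"
    using oct by (force simp: complete_3partite_def)+
  then show ?thesis
    by (intro has_berge_K4_thirdsI[of a a' b c x H c' b' c' b' a]) (use e(1) x dist in auto)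
qed

text \<open>Take the core \<open>v, a, b, c\<close>. Each pair of the transversal is covered by the
  octahedron triple whose third point is the partner of the omitted core point. These triples avoid
  \<open>v\<close>, so they cannot collide with \<open>ea\<close>, \<open>eb\<close>,
  \<open>ec\<close>.\<close>

lemma octahedron_transversal:
  assumes oct: "complete_3partite {a, a'} {b, b'} {c, c'} \<subseteq> H"
    and dist: "distinct [a, a', b, b', c, c', v]"
    and e: "ea \<in> H" "eb \<in> H" "ec \<in> H" "distinct [ea, eb, ec]"
      "{v, a} \<subseteq> ea" "{v, b} \<subseteq> eb" "{v, c} \<subseteq> ec"
  shows "has_berge_K4 H"
proof -
  have H: "{a, b, c'} \<in> H" "{a, c, b'} \<in> H" "{b, c, a'} \<in> H"
    using oct by (force simp: complete_3partite_def)+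
  have "\<forall>x \<in> set [ea, eb, ec]. v \<in> x" "\<forall>x \<in> set [{a, b, c'}, {a, c, b'}, {b, c, a'}]. v \<notin> x"
    using e dist by auto
  then have disj: "set [ea, eb, ec] \<inter> set [{a, b, c'}, {a, c, b'}, {b, c, a'}] = {}" by blast
  have "b \<notin> {a, c, b'}" "a \<notin> {b, c, a'}" using dist by auto
  then have "{a, b, c'} \<noteq> {a, c, b'}" "{a, b, c'} \<noteq> {b, c, a'}" "{a, c, b'} \<noteq> {b, c, a'}"
    by (metis insertI1 insertI2)+
  then have "distinct ([ea, eb, ec] @ [{a, b, c'}, {a, c, b'}, {b, c, a'}])"
    unfolding distinct_append using e(4) disj by simp
  then have d: "distinct [ea, eb, ec, {a, b, c'}, {a, c, b'}, {b, c, a'}]" by (simp only: append.simps)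
  have "distinct [v, a, b, c]" using dist by auto
  then show ?thesis
    by (rule has_berge_K4I[OF _ d e(1-3) H e(5-7)]) simp_all
qed

text \<open>Two complete triple systems on four points, \<open>{a, a', b, b'}\<close> and \<open>{a, a', c, c'}\<close>, sharing the
  pair \<open>{a, a'}\<close>: besides the octahedron the only B-free system with eight triples on six points.\<close>

definition double_K4 :: "'a \<Rightarrow> 'a \<Rightarrow> 'a \<Rightarrow> 'a \<Rightarrow> 'a \<Rightarrow> 'a \<Rightarrow> 'a set set" where
  "double_K4 a a' b b' c c' =
     {{a, a', b}, {a, a', b'}, {a, b, b'}, {a', b, b'}, {a, a', c}, {a, a', c'}, {a, c, c'}, {a', c, c'}}"

text \<open>Take the core \<open>a, a', b, c\<close>: with third points \<open>b'\<close> and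
  \<open>c'\<close> the system already covers all its pairs except \<open>b, c\<close>.\<close>

lemma double_K4_cross_pair:
  assumes D: "double_K4 a a' b b' c c' \<subseteq> H" and dist: "distinct [a, a', b, b', c, c']"
    and e: "{b, c, x} \<in> H" "x \<notin> {b, c}"
  shows "has_berge_K4 H"
  by (rule has_berge_K4_thirdsI[of a a' b c b' H b' c' b' c' x])
    (use D dist e in \<open>auto simp: double_K4_def insert_commute\<close>)

text \<open>Take the core \<open>a, a', b, b'\<close>. Its four inner triples and one triple through
  \<open>a, a'\<close> from the other side make five, and an outside triple on any further pair is
  the sixth. The next lemma uses the same core.\<close>

lemma double_K4_mixed_pair:
  assumes D: "double_K4 a a' b b' c c' \<subseteq> H" and dist: "distinct [a, a', b, b', c, c']"
    and e: "{a, b, x} \<in> H" "x \<notin> {a, a', b, b', c, c'}"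
  shows "has_berge_K4 H"
  by (rule has_berge_K4_thirdsI[of a a' b b' c H x b a a a'])
    (use D dist e in \<open>auto simp: double_K4_def insert_commute\<close>)

lemma double_K4_page_pair:
  assumes D: "double_K4 a a' b b' c c' \<subseteq> H" and dist: "distinct [a, a', b, b', c, c']"
    and e: "{b, b', x} \<in> H" "x \<notin> {a, a', b, b', c, c'}"
  shows "has_berge_K4 H"
  by (rule has_berge_K4_thirdsI[of a a' b b' c H a' b b' a x])
    (use D dist e in \<open>auto simp: double_K4_def insert_commute\<close>)

lemma double_K4_swap: "double_K4 a a' b b' c c' = double_K4 a' a b b' c c'"
  "double_K4 a a' b b' c c' = double_K4 a a' b' b c c'"
  "double_K4 a a' b b' c c' = double_K4 a a' c c' b b'"
  by (simp_all add: double_K4_def insert_commute)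

subsection \<open>Eight triples on six points\<close>

type_synonym code = "nat \<times> nat \<times> nat"

definition pairs6 :: "(nat \<times> nat) list" where
  "pairs6 = [(0, 1), (0, 2), (0, 3), (0, 4), (0, 5), (1, 2), (1, 3), (1, 4), (1, 5), (2, 3), (2, 4), (2, 5), (3, 4), (3, 5), (4, 5)]"

text \<open>A code \<open>(a, b, c)\<close> always satisfies \<open>a < b < c\<close>, and a pair \<open>(x, y)\<close> satisfies \<open>x < y\<close>.\<close>

fun covers :: "nat \<times> nat \<Rightarrow> code \<Rightarrow> bool" where
  "covers (x, y) (a, b, c) \<longleftrightarrow> (x = a \<or> x = b) \<and> (y = b \<or> y = c)"

definition codes :: "code list" where
  "codes = [(0, 1, 2), (0, 1, 3), (0, 1, 4), (0, 1, 5), (0, 2, 3), (0, 2, 4), (0, 2, 5), (0, 3, 4), (0, 3, 5), (0, 4, 5), (1, 2, 3), (1, 2, 4), (1, 2, 5), (1, 3, 4), (1, 3, 5), (1, 4, 5), (2, 3, 4), (2, 3, 5), (2, 4, 5), (3, 4, 5)]"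

definition mask :: "nat \<Rightarrow> bool list" where
  "mask i = map (\<lambda>p. covers p (codes ! i)) pairs6"

text \<open>From a list indexed by the fifteen pairs, the six entries belonging to each four-point set.\<close>

fun quads :: "'b list \<Rightarrow> 'b list list" where
  "quads [p01, p02, p03, p04, p05, p12, p13, p14, p15, p23, p24, p25, p34, p35, p45] =
   [[p01, p02, p03, p12, p13, p23],
    [p01, p02, p04, p12, p14, p24],
    [p01, p02, p05, p12, p15, p25],
    [p01, p03, p04, p13, p14, p34],
    [p01, p03, p05, p13, p15, p35],
    [p01, p04, p05, p14, p15, p45],
    [p02, p03, p04, p23, p24, p34],
    [p02, p03, p05, p23, p25, p35],
    [p02, p04, p05, p24, p25, p45],
    [p03, p04, p05, p34, p35, p45],
    [p12, p13, p14, p23, p24, p34],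
    [p12, p13, p15, p23, p25, p35],
    [p12, p14, p15, p24, p25, p45],
    [p13, p14, p15, p34, p35, p45],
    [p23, p24, p25, p34, p35, p45]]"
| "quads _ = []"

text \<open>Backtracking for a system of distinct representatives that avoids the used values
  \<open>us\<close>. Applied to the six lists of a four-point set, with indices of covering triples
  as values, success means a Berge-K_4 with that core.\<close>

fun sdr :: "nat list list \<Rightarrow> nat list \<Rightarrow> bool"
  and pick :: "nat list \<Rightarrow> nat list list \<Rightarrow> nat list \<Rightarrow> bool" where
  "sdr [] us = True"
| "sdr (l # ls) us = pick l ls us"
| "pick [] ls us = False"
| "pick (x # xs) ls us =
    (if x \<in> set us then pick xs ls us
     else if sdr ls (x # us) then True else pick xs ls us)"

fun any_sdr :: "nat list list list \<Rightarrow> bool" where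
  "any_sdr [] = False"
| "any_sdr (q # qs) = (if sdr q [] then True else any_sdr qs)"

fun add_index :: "bool list \<Rightarrow> nat \<Rightarrow> nat list list \<Rightarrow> nat list list" where
  "add_index (b # bs) t (l # ls) = (if b then t # l else l) # add_index bs t ls"
| "add_index _ t ls = ls"

text \<open>One labeling for each octahedron and each double \<open>K\<^sub>4\<close> that contains the triples \<open>012\<close> and
  \<open>013\<close>, from which the search starts.\<close>

definition labelings :: "nat list list" where
  "labelings = [[0, 1, 2, 3, 4, 5], [0, 1, 2, 4, 3, 5], [0, 1, 2, 5, 3, 4], [0, 2, 1, 3, 4, 5], [0, 3, 1, 2, 4, 5], [0, 4, 1, 5, 2, 3], [0, 5, 1, 4, 2, 3], [1, 2, 0, 3, 4, 5], [1, 3, 0, 2, 4, 5], [2, 3, 0, 1, 4, 5]]"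

fun octahedron_codes :: "nat list \<Rightarrow> nat list list" where
  "octahedron_codes [a, a', b, b', c, c'] =
     [[a, b, c], [a, b, c'], [a, b', c], [a, b', c'], [a', b, c], [a', b, c'], [a', b', c], [a', b', c']]"
| "octahedron_codes _ = []"

fun double_K4_codes :: "nat list \<Rightarrow> nat list list" where
  "double_K4_codes [a, a', b, b', c, c'] =
     [[a, a', b], [a, a', b'], [a, b, b'], [a', b, b'], [a, a', c], [a, a', c'], [a, c, c'], [a', c, c']]"
| "double_K4_codes _ = []"

text \<open>Triples are compared as sets because a labeling may list the points of a triple in any
  order.\<close>

definition has_code :: "nat list \<Rightarrow> nat list \<Rightarrow> bool" where
  "has_code S t = list_ex (\<lambda>i. case codes ! i of (x, y, z) \<Rightarrow> set [x, y, z] = set t) S"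

definition accept :: "nat list \<Rightarrow> bool" where
  "accept S = list_ex (\<lambda>L. list_all (has_code S) (octahedron_codes L) \<or>
     list_all (has_code S) (double_K4_codes L)) labelings"

text \<open>In \<open>search k s r cov S\<close> the indices \<open>S\<close> of codes have been chosen, \<open>cov\<close> lists for every pair the
  chosen codes covering it, at least \<open>k\<close> of the candidates \<open>r\<close> are still to be chosen, and at most \<open>s\<close> may be
  skipped. As eight codes are chosen in total, \<open>k \<le> 2\<close> means that there are at least six of them.\<close>

fun search :: "nat \<Rightarrow> nat \<Rightarrow> (nat \<times> bool list) list \<Rightarrow> nat list list \<Rightarrow> nat list \<Rightarrow> bool" where
  "search 0 s r cov S = accept S"
| "search (Suc k) s [] cov S = True"
| "search (Suc k) s ((i, m) # r) cov S =
    ((let cov' = add_index m i cov in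
      if (if k \<le> 2 then any_sdr (quads cov') else False) then True else search k s r cov' (i # S)) \<and>
     (case s of 0 \<Rightarrow> True | Suc s' \<Rightarrow> search (Suc k) s' r cov S))"

text \<open>Indices 0 and 1 are the codes of \<open>012\<close> and \<open>013\<close>. Six of the
  eighteen other codes remain to be chosen, so twelve may be skipped.\<close>

lemma search_start:
  "search 6 12 (map (\<lambda>i. (i, mask i)) [2..<20])
     (map (\<lambda>p. filter (\<lambda>i. covers p (codes ! i)) [0, 1]) pairs6) [0, 1]"
  by code_simp

section \<open>Soundness of the search\<close>

fun tri :: "(nat \<Rightarrow> 'a) \<Rightarrow> code \<Rightarrow> 'a set" where
  "tri v (a, b, c) = {v a, v b, v c}"

declare covers.simps [simp del]

lemma sdr_sound:
  "sdr ls us \<Longrightarrow> \<exists>es. distinct es \<and> set es \<inter> set us = {} \<and> list_all2 (\<lambda>e l. e \<in> set l) es ls"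
  "pick l ls us \<Longrightarrow> \<exists>es. distinct es \<and> set es \<inter> set us = {} \<and> list_all2 (\<lambda>e l. e \<in> set l) es (l # ls)"
proof (induction ls us and l ls us rule: sdr_pick.induct)
  case (4 x xs ls us)
  show ?case
  proof (cases "x \<notin> set us \<and> sdr ls (x # us)")
    case True
    then obtain es where "distinct es" "set es \<inter> set (x # us) = {}" "list_all2 (\<lambda>e l. e \<in> set l) es ls"
      using 4 by auto
    then have "distinct (x # es)" "set (x # es) \<inter> set us = {}"
      "list_all2 (\<lambda>e l. e \<in> set l) (x # es) ((x # xs) # ls)"
      using True by auto
    then show ?thesis by blast
  next
    case False
    then have "pick xs ls us" using 4(4) by (auto split: if_splits)
    then obtain es where "distinct es" "set es \<inter> set us = {}" "list_all2 (\<lambda>e l. e \<in> set l) es (xs # ls)"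
      using 4(1,3) False by (cases "x \<in> set us") auto
    then show ?thesis by (auto simp: list_all2_Cons2)
  qed
qed auto

lemma covers_subset: "covers (x, y) t \<Longrightarrow> {v x, v y} \<subseteq> tri v t"
  by (cases t) (auto simp: covers.simps)

text \<open>\<open>quads\<close> merely selects positions, so it respects any relation between
  entries. Comparison with \<open>quads pairs6\<close> then tells which four points a list of
  candidates belongs to.\<close>

lemma quads_list_all2:
  assumes "list_all2 R pairs6 cov" shows "list_all2 (list_all2 R) (quads pairs6) (quads cov)"
  using assms by (auto simp: pairs6_def list_all2_Cons1)

lemma quads_pairs6:
  "\<forall>q \<in> set (quads pairs6). \<exists>i j k l. distinct [i, j, k, l] \<and> {i, j, k, l} \<subseteq> {..<6} \<and>
     q = [(i, j), (i, k), (i, l), (j, k), (j, l), (k, l)]"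
  by (simp add: pairs6_def)

lemma any_sdr_sound:
  assumes "any_sdr (quads cov)" and inj: "inj_on v {..<6}" and tri: "inj_on (\<lambda>i. tri v (codes ! i)) X"
    and cov: "list_all2 (\<lambda>p l. \<forall>t \<in> set l. t \<in> X \<and> tri v (codes ! t) \<in> H \<and> covers p (codes ! t)) pairs6 cov"
  shows "has_berge_K4 H"
proof -
  have "any_sdr qs \<Longrightarrow> \<exists>q \<in> set qs. sdr q []" for qs
    by (induction qs) (auto split: if_splits)
  then obtain q where q: "q \<in> set (quads cov)" "sdr q []" using assms(1) by blast
  then obtain n where n: "n < length (quads cov)" "q = quads cov ! n" by (metis in_set_conv_nth)
  define ps where "ps = quads pairs6 ! n"
  have ps: "ps \<in> set (quads pairs6)"
    "list_all2 (\<lambda>p l. \<forall>t \<in> set l. t \<in> X \<and> tri v (codes ! t) \<in> H \<and> covers p (codes ! t)) ps q"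
    using list_all2_lengthD[OF quads_list_all2[OF cov]] list_all2_nthD2[OF quads_list_all2[OF cov] n(1)] n
    unfolding ps_def by simp_all
  obtain i j k l where ijkl: "distinct [i, j, k, l]" "{i, j, k, l} \<subseteq> {..<6}"
    and ps_eq: "ps = [(i, j), (i, k), (i, l), (j, k), (j, l), (k, l)]"
    using ps(1) quads_pairs6 by blast
  obtain es where es: "distinct es" "list_all2 (\<lambda>e l. e \<in> set l) es q"
    using sdr_sound(1)[OF q(2)] by auto
  have "list_all2 (\<lambda>p e. e \<in> X \<and> tri v (codes ! e) \<in> H \<and> covers p (codes ! e)) ps es"
    using ps(2) es(2) by (auto simp: list_all2_conv_all_nth)
  then obtain e1 e2 e3 e4 e5 e6 where es_eq: "es = [e1, e2, e3, e4, e5, e6]"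
    and X: "{e1, e2, e3, e4, e5, e6} \<subseteq> X"
    and H: "tri v (codes ! e1) \<in> H" "tri v (codes ! e2) \<in> H" "tri v (codes ! e3) \<in> H" "tri v (codes ! e4) \<in> H" "tri v (codes ! e5) \<in> H" "tri v (codes ! e6) \<in> H"
    and c: "covers (i, j) (codes ! e1)" "covers (i, k) (codes ! e2)" "covers (i, l) (codes ! e3)"
      "covers (j, k) (codes ! e4)" "covers (j, l) (codes ! e5)" "covers (k, l) (codes ! e6)"
    unfolding ps_eq list_all2_Cons1 list.rel_sel[of _ "[]"] by (elim exE conjE) (rule that; simp)
  have "distinct (map v [i, j, k, l])"
    unfolding distinct_map using ijkl inj_on_subset[OF inj ijkl(2)] by simp
  then have "distinct [v i, v j, v k, v l]" by simp
  moreover have "distinct (map (\<lambda>i. tri v (codes ! i)) es)"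
    unfolding distinct_map using es(1) inj_on_subset[OF tri X] by (simp add: es_eq)
  then have "distinct [tri v (codes ! e1), tri v (codes ! e2), tri v (codes ! e3), tri v (codes ! e4), tri v (codes ! e5), tri v (codes ! e6)]"
    unfolding es_eq by simp
  ultimately show ?thesis
    by (rule has_berge_K4I[OF _ _ H c[THEN covers_subset]])
qed

lemma add_index_list_all2:
  assumes "list_all2 (\<lambda>p l. \<forall>t \<in> set l. P t \<and> covers p (codes ! t)) ps cov" and "P t"
  shows "list_all2 (\<lambda>p l. \<forall>t \<in> set l. P t \<and> covers p (codes ! t)) ps (add_index (map (\<lambda>p. covers p (codes ! t)) ps) t cov)"
  using assms by (induction rule: list_all2_induct) auto

text \<open>Follow the branch that chooses a code exactly when its triple is in \<open>H\<close>.
  Pruning never cuts this branch, since a representative system would be a Berge-K_4 in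
  \<open>H\<close>. The invariants on \<open>k\<close>, \<open>s\<close> and the length of
  \<open>r\<close> ensure that the branch runs out of neither candidates nor permitted skips before
  \<open>accept\<close> is reached.\<close>

lemma search_sound:
  assumes "search k s r cov S" and inj: "inj_on v {..<6}" and tri: "inj_on (\<lambda>i. tri v (codes ! i)) X"
    and "\<not> has_berge_K4 H"
    and "list_all2 (\<lambda>p l. \<forall>t \<in> set l. (t \<in> X \<and> tri v (codes ! t) \<in> H) \<and> covers p (codes ! t)) pairs6 cov"
    and "fst ` set r \<subseteq> X" and "\<forall>(t, m) \<in> set r. m = mask t"
    and "k \<le> length (filter (\<lambda>(t, m). tri v (codes ! t) \<in> H) r)" and "length r \<le> k + s"
    and "\<forall>t \<in> set S. tri v (codes ! t) \<in> H"
  shows "\<exists>S. accept S \<and> (\<forall>t \<in> set S. tri v (codes ! t) \<in> H)"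
  using assms(1,5-)
proof (induction k s r cov S rule: search.induct)
  case (1 s r cov S)
  then show ?case by auto
next
  case (2 k s cov S)
  then show ?case by simp
next
  case (3 k s t m r cov S)
  have m: "m = mask t" and tX: "t \<in> X" using 3 by auto
  show ?case
  proof (cases "tri v (codes ! t) \<in> H")
    case True
    let ?cov = "add_index m t cov"
    have cov: "list_all2 (\<lambda>p l. \<forall>t \<in> set l. (t \<in> X \<and> tri v (codes ! t) \<in> H) \<and> covers p (codes ! t)) pairs6 ?cov"
      unfolding m mask_def by (rule add_index_list_all2) (use 3 True tX in auto)
    then have nb: "\<not> any_sdr (quads ?cov)"
      using any_sdr_sound[OF _ inj tri, of ?cov H] \<open>\<not> has_berge_K4 H\<close> by auto
    have "search k s r ?cov (t # S)" using 3(3) nb by (auto simp: Let_def split: if_splits)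
    then show ?thesis
      by (intro 3(1)[OF refl]) (use 3(4-) True cov nb in auto)
  next
    case False
    \<comment> \<open>The skipped code is not in \<open>H\<close>, so more than \<open>k\<close>
      members remain in \<open>r\<close>; together with the length bound this makes \<open>s\<close>
      positive.\<close>
    have "k < length (filter (\<lambda>(t, m). tri v (codes ! t) \<in> H) r)" using 3 False by auto
    also have "\<dots> \<le> length r" by simp
    finally obtain s' where s: "s = Suc s'" using 3 by (cases s) auto
    then show ?thesis
      by (intro 3(2)[OF s]) (use 3(3-) False in auto)
  qed
qed

section \<open>Relabeling six-point systems for the search\<close>

lemma tri_conv: "tri v t = v ` tri id t"
  by (cases t) auto

text \<open>An increasing code is the sorted list of its own point set.\<close>

lemma tri_id_inj: "inj_on (tri id) {(a, b, c). a < b \<and> b < c}"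
proof (rule inj_onI)
  fix s t :: code assume st: "s \<in> {(a, b, c). a < b \<and> b < c}" "t \<in> {(a, b, c). a < b \<and> b < c}"
    and tri: "tri id s = tri id t"
  obtain a b c a' b' c' where s: "s = (a, b, c)" and t: "t = (a', b', c')" by (metis prod_cases3)
  have lt: "a < b" "b < c" "a' < b'" "b' < c'" using st s t by auto
  have eq: "{a, b, c} = {a', b', c'}" using tri unfolding s t tri.simps id_apply .
  have sl: "sorted_list_of_set {a, b, c} = [a, b, c]" "sorted_list_of_set {a', b', c'} = [a', b', c']"
    using lt by auto
  have "[a, b, c] = [a', b', c']" by (rule trans[OF sl(1)[unfolded eq, symmetric] sl(2)])
  then show "s = t" unfolding s t by simp
qed

lemma six_point_search:
  assumes v: "inj_on v {..<6}" and H: "triple_system (v ` {..<6}) H" and "\<not> has_berge_K4 H"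
    and "8 \<le> card H" and start: "{v 0, v 1, v 2} \<in> H" "{v 0, v 1, v 3} \<in> H"
  shows "\<exists>S. accept S \<and> (\<forall>i \<in> set S. tri v (codes ! i) \<in> H)"
proof -
  let ?C = "{(a, b, c). a < b \<and> b < c \<and> c < 6}" and ?T = "\<lambda>i. tri v (codes ! i)"
  have C: "?C = set codes"
  proof -
    have "?C = set [(a, b, c). a \<leftarrow> [0..<6], b \<leftarrow> [0..<6], c \<leftarrow> [0..<6], a < b \<and> b < c]"
      by auto
    also have "\<dots> = set codes" by code_simp
    finally show ?thesis .
  qed
  have tri: "inj_on (tri v) ?C"
  proof (rule inj_onI)
    fix s t assume st: "s \<in> ?C" "t \<in> ?C" "tri v s = tri v t"
    then have "tri id s \<subseteq> {..<6}" "tri id t \<subseteq> {..<6}" by auto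
    then have "tri id s = tri id t" using st(3) inj_on_image_eq_iff[OF v] unfolding tri_conv[of v] by blast
    then show "s = t" by (rule inj_onD[OF tri_id_inj]) (use st in auto)
  qed
  have len: "length codes = 20" and dist: "distinct codes" by (simp_all add: codes_def)
  have inj: "inj_on ?T {..<20}"
  proof (rule inj_onI)
    fix i j assume ij: "i \<in> {..<20}" "j \<in> {..<20}" "?T i = ?T j"
    then have "codes ! i \<in> ?C" "codes ! j \<in> ?C" unfolding C using len by auto
    then have "codes ! i = codes ! j" by (rule inj_onD[OF tri ij(3)])
    then show "i = j" using ij len dist by (simp add: nth_eq_iff_index_eq)
  qed
  have sub: "H \<subseteq> ?T ` {..<20}"
  proof
    fix e assume "e \<in> H"
    then have "e \<subseteq> v ` {..<6}" "card e = 3" using H by (auto simp: triple_system_def)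
    then obtain g where g: "g \<subseteq> {..<6}" "e = v ` g" by (meson subset_imageE)
    then have "card g = 3" using \<open>card e = 3\<close> card_image[of v g] v by (metis inj_on_subset)
    then have "length (sorted_list_of_set g) = 3" by simp
    moreover have "length xs = 3 \<Longrightarrow> \<exists>a b c. xs = [a, b, c]" for xs :: "nat list"
      by (auto simp: numeral_3_eq_3 length_Suc_conv)
    ultimately obtain a b c where abc: "sorted_list_of_set g = [a, b, c]" by blast
    have "finite g" using g finite_subset by blast
    then have g_eq: "g = {a, b, c}" using abc set_sorted_list_of_set[of g] by simp
    moreover have "a < b" "b < c"
      using strict_sorted_list_of_set[of g] unfolding abc by auto
    ultimately have "(a, b, c) \<in> ?C" using g by auto
    then obtain i where "i < 20" "codes ! i = (a, b, c)" unfolding C in_set_conv_nth len by blast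
    then show "e \<in> ?T ` {..<20}" using g g_eq by (intro image_eqI[of _ _ i]) auto
  qed
  have "H \<subseteq> ?T ` set (filter (\<lambda>i. ?T i \<in> H) [0..<20])"
    using sub by (auto simp: atLeast0LessThan)
  then have "card H \<le> card (set (filter (\<lambda>i. ?T i \<in> H) [0..<20]))"
    by (intro surj_card_le) auto
  also have "\<dots> \<le> length (filter (\<lambda>i. ?T i \<in> H) [0..<20])" by (rule card_length)
  \<comment> \<open>At most two members have index 0 or 1, so at least six are left for the
    candidates.\<close>
  also have "[0..<20] = [0, 1] @ [2..<20]" by (simp add: upt_rec)
  also have "length (filter (\<lambda>i. ?T i \<in> H) ([0, 1] @ [2..<20])) \<le> 2 + length (filter (\<lambda>i. ?T i \<in> H) [2..<20])"
    by simp
  finally have len6: "6 \<le> length (filter (\<lambda>i. ?T i \<in> H) [2..<20])" using assms(4) by linarith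
  have "filter (\<lambda>(i, m). ?T i \<in> H) (map (\<lambda>i. (i, mask i)) [2..<20]) =
      map (\<lambda>i. (i, mask i)) (filter (\<lambda>i. ?T i \<in> H) [2..<20])"
    unfolding filter_map comp_def by simp
  then have len6': "6 \<le> length (filter (\<lambda>(i, m). ?T i \<in> H) (map (\<lambda>i. (i, mask i)) [2..<20]))"
    using len6 by (simp only: length_map)
  have S: "\<forall>i \<in> set [0, 1]. i \<in> {..<20} \<and> ?T i \<in> H" using start by (simp add: codes_def)
  show ?thesis
  proof (rule search_sound[OF search_start v inj assms(3) _ _ _ len6'])
    show "list_all2 (\<lambda>p l. \<forall>t \<in> set l. (t \<in> {..<20} \<and> ?T t \<in> H) \<and> covers p (codes ! t)) pairs6
        (map (\<lambda>p. filter (\<lambda>i. covers p (codes ! i)) [0, 1]) pairs6)"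
      unfolding list.rel_map by (rule list.rel_refl) (use S in auto)
    show "length (map (\<lambda>i. (i, mask i)) [2..<20]) \<le> 6 + 12" by simp
  qed (use S in auto)
qed

lemma has_code_sound:
  assumes "has_code S t" "\<forall>i \<in> set S. tri v (codes ! i) \<in> H" shows "v ` set t \<in> H"
proof -
  obtain i x y z where "i \<in> set S" "codes ! i = (x, y, z)" "set [x, y, z] = set t"
    using assms(1) by (auto simp: has_code_def list_ex_iff)
  moreover have "tri v (x, y, z) = v ` set [x, y, z]" by simp
  ultimately show ?thesis using assms(2) by metis
qed

lemma accept_sound:
  assumes "accept S" and H: "\<forall>i \<in> set S. tri v (codes ! i) \<in> H" and inj: "inj_on v {..<6}"
  obtains a a' b b' c c' where "distinct [a, a', b, b', c, c']" "v ` {..<6} = {a, a', b, b', c, c'}"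
    "complete_3partite {a, a'} {b, b'} {c, c'} \<subseteq> H \<or> double_K4 a a' b b' c c' \<subseteq> H"
proof -
  obtain L where L: "L \<in> set labelings"
    "list_all (has_code S) (octahedron_codes L) \<or> list_all (has_code S) (double_K4_codes L)"
    using assms(1) by (auto simp: accept_def list_ex_iff)
  have "\<forall>L \<in> set labelings. length L = 6 \<and> distinct L \<and> set L = set [0..<6]"
    unfolding labelings_def by code_simp
  then have "length L = 6" and dist: "distinct L" and set: "set L = {..<6}"
    using L by (auto simp: lessThan_atLeast0)
  then obtain a a' b b' c c' where L_eq: "L = [a, a', b, b', c, c']"
    by (auto simp: numeral_eq_Suc length_Suc_conv)
  have "distinct (map v L)" unfolding distinct_map using dist set inj by simp
  then have "distinct [v a, v a', v b, v b', v c, v c']" unfolding L_eq by simp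
  moreover have "v ` {..<6} = {v a, v a', v b, v b', v c, v c'}"
    unfolding set[symmetric] L_eq by simp
  moreover have "complete_3partite {v a, v a'} {v b, v b'} {v c, v c'} \<subseteq> H \<or>
      double_K4 (v a) (v a') (v b) (v b') (v c) (v c') \<subseteq> H"
    using L(2)
  proof
    assume "list_all (has_code S) (octahedron_codes L)"
    then have "\<forall>t \<in> set (octahedron_codes L). v ` set t \<in> H"
      using has_code_sound[OF _ H] by (auto simp: list_all_iff)
    then show ?thesis unfolding L_eq by (auto simp: complete_3partite_def)
  next
    assume "list_all (has_code S) (double_K4_codes L)"
    then have "\<forall>t \<in> set (double_K4_codes L). v ` set t \<in> H"
      using has_code_sound[OF _ H] by (auto simp: list_all_iff)
    then show ?thesis unfolding L_eq by (auto simp: double_K4_def)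
  qed
  ultimately show thesis by (rule that)
qed

text \<open>Triples without a common pair occupy three pairs each, all different. On six points 15 <
  24, which justifies starting the search from two triples with a common pair.\<close>

lemma two_triples_sharing_pair:
  assumes H: "triple_system V H" and V: "finite V" and card: "card V choose 2 < 3 * card H"
  obtains e f x y where "e \<in> H" "f \<in> H" "e \<noteq> f" "x \<noteq> y" "{x, y} \<subseteq> e" "{x, y} \<subseteq> f"
proof (rule ccontr)
  assume "\<not> thesis"
  then have no: "\<not> ({x, y} \<subseteq> e \<and> {x, y} \<subseteq> f)" if "e \<in> H" "f \<in> H" "e \<noteq> f" "x \<noteq> y" for e f x y
    using that(1-4) \<open>\<And>e f x y. e \<in> H \<Longrightarrow> f \<in> H \<Longrightarrow> e \<noteq> f \<Longrightarrow> x \<noteq> y \<Longrightarrow> {x, y} \<subseteq> e \<Longrightarrow> {x, y} \<subseteq> f \<Longrightarrow> thesis\<close>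
    by metis
  define P where "P e = {p. p \<subseteq> e \<and> card p = 2}" for e :: "'a set"
  have fin: "finite e" "card e = 3" "e \<subseteq> V" if "e \<in> H" for e
    using H that by (auto simp: triple_system_def intro: card_ge_0_finite)
  have cP: "card (P e) = 3" if "e \<in> H" for e
    unfolding P_def using n_subsets[OF fin(1)[OF that], of 2] fin(2)[OF that] by (simp add: choose_two)
  have finP: "finite (P e)" if "e \<in> H" for e
    using cP[OF that] by (intro card_ge_0_finite) simp
  have "P e \<inter> P f = {}" if ef: "e \<in> H" "f \<in> H" "e \<noteq> f" for e f
  proof (rule ccontr)
    assume "P e \<inter> P f \<noteq> {}"
    then obtain p where p: "p \<subseteq> e" "p \<subseteq> f" "card p = 2" by (auto simp: P_def)
    then obtain x y where "p = {x, y}" "x \<noteq> y" by (auto simp: card_2_iff)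
    then show False using no[OF ef, of x y] p by simp
  qed
  then have "card (\<Union> (P ` H)) = (\<Sum>e \<in> H. card (P e))"
    by (intro card_UN_disjoint) (use triple_system_finite[OF H V] finP in auto)
  also have "\<dots> = 3 * card H" using cP by simp
  finally have "3 * card H = card (\<Union> (P ` H))" ..
  also have "\<dots> \<le> card {p. p \<subseteq> V \<and> card p = 2}"
    by (rule card_mono) (use V fin(3) in \<open>auto simp: P_def dest: subsetD\<close>)
  also have "\<dots> = card V choose 2" by (rule n_subsets[OF V])
  finally show False using card by simp
qed

lemma six_points:
  assumes H: "triple_system V H" and V: "card V = 6" and free: "B_free H" and card: "8 \<le> card H"
  obtains a a' b b' c c' where "distinct [a, a', b, b', c, c']" "V = {a, a', b, b', c, c'}"
    "complete_3partite {a, a'} {b, b'} {c, c'} \<subseteq> H \<or> double_K4 a a' b b' c c' \<subseteq> H"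
proof -
  have fin: "finite V" using V by (intro card_ge_0_finite) simp
  obtain e f x y where ef: "e \<in> H" "f \<in> H" "e \<noteq> f" "x \<noteq> y" "{x, y} \<subseteq> e" "{x, y} \<subseteq> f"
    by (rule two_triples_sharing_pair[OF H fin]) (use V card in \<open>auto simp: choose_two\<close>)
  have c3: "card e = 3" "card f = 3" "e \<subseteq> V" "f \<subseteq> V"
    using ef H by (auto simp: triple_system_def)
  obtain z where z: "e = {x, y, z}" "z \<notin> {x, y}"
    using triple_third[OF c3(1) ef(5) ef(4)] by blast
  obtain w where w: "f = {x, y, w}" "w \<notin> {x, y}"
    using triple_third[OF c3(2) ef(6) ef(4)] by blast
  have dist: "distinct [x, y, z, w]" using ef z w by auto
  have sub: "{x, y, z, w} \<subseteq> V" using c3 z w by auto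
  have "card (V - {x, y, z, w}) = 2"
    using sub dist V by (simp add: card_Diff_subset)
  then obtain p q where pq: "V - {x, y, z, w} = {p, q}" "p \<noteq> q" by (auto simp: card_2_iff)
  \<comment> \<open>The common pair gets the labels 0 and 1 and the two third points the labels 2
    and 3, as the search presupposes; the order of the last two points is arbitrary.\<close>
  define L where "L = [x, y, z, w, p, q]"
  have "{p, q} \<inter> {x, y, z, w} = {}" using pq(1) by blast
  then have L: "distinct L" using dist pq(2) by (auto simp: L_def)
  have "V = {x, y, z, w} \<union> {p, q}" using pq(1) sub by blast
  then have setL: "set L = V" by (auto simp: L_def)
  have len: "length L = 6" by (simp add: L_def)
  have inj: "inj_on ((!) L) {..<6}" using L len by (simp add: inj_on_nth)
  have img: "(!) L ` {..<6} = V" using setL len nth_image[of 6 L] by (simp add: lessThan_atLeast0)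
  have "{L ! 0, L ! 1, L ! 2} \<in> H" "{L ! 0, L ! 1, L ! 3} \<in> H"
    using ef z w by (simp_all add: L_def)
  then obtain S where "accept S" "\<forall>i \<in> set S. tri ((!) L) (codes ! i) \<in> H"
    using six_point_search[OF inj, of H] H free card unfolding img B_free_def by auto
  from accept_sound[OF this inj] show thesis using that unfolding img by blast
qed

subsection \<open>Octahedra, double complete systems and their links\<close>

lemma sum_card_incidence:
  assumes "finite X" "finite H"
  shows "(\<Sum>x \<in> X. card {e \<in> H. x \<in> e}) = (\<Sum>e \<in> H. card (e \<inter> X))"
proof -
  have "(\<Sum>x \<in> X. card {e \<in> H. x \<in> e}) = (\<Sum>x \<in> X. \<Sum>e \<in> H. if x \<in> e then 1 else 0)"
    using assms(2) by (simp add: sum.If_cases Int_def)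
  also have "\<dots> = (\<Sum>e \<in> H. \<Sum>x \<in> X. if x \<in> e then 1 else 0)" by (rule sum.swap)
  also have "\<dots> = (\<Sum>e \<in> H. card (e \<inter> X))"
    using assms(1) by (simp add: sum.If_cases Int_def conj_commute)
  finally show ?thesis .
qed

lemma sum_degrees:
  assumes "triple_system V H" "finite V"
  shows "(\<Sum>v \<in> V. card {e \<in> H. v \<in> e}) = 3 * card H"
proof -
  have "card (e \<inter> V) = 3" if "e \<in> H" for e
    using assms(1) that by (auto simp: triple_system_def Int_absorb2)
  then show ?thesis
    using sum_card_incidence[OF assms(2) triple_system_finite[OF assms]] by simp
qed

lemma sum_codegrees:
  assumes "triple_system V H" "finite V"
  shows "(\<Sum>u \<in> V - {v}. card {e \<in> H. {u, v} \<subseteq> e}) = 2 * card {e \<in> H. v \<in> e}"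
proof -
  have "card (e \<inter> (V - {v})) = 2" if "e \<in> {e \<in> H. v \<in> e}" for e
  proof -
    have "e \<subseteq> V" "card e = 3" "v \<in> e" using assms(1) that by (auto simp: triple_system_def)
    moreover from this have "e \<inter> (V - {v}) = e - {v}" by blast
    ultimately show ?thesis by simp
  qed
  then show ?thesis
    using sum_card_incidence[of "V - {v}" "{e \<in> H. v \<in> e}"] triple_system_finite[OF assms] assms(2)
    by (simp add: conj_ac)
qed

lemma triple_system_delete:
  "triple_system V H \<Longrightarrow> triple_system (V - {v}) {e \<in> H. v \<notin> e}"
  unfolding triple_system_def by auto

lemma card_split_vertex:
  assumes "finite H" shows "card H = card {e \<in> H. v \<in> e} + card {e \<in> H. v \<notin> e}"
proof -
  have "H = {e \<in> H. v \<in> e} \<union> {e \<in> H. v \<notin> e}" by blast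
  then show ?thesis using card_Un_disjoint[of "{e \<in> H. v \<in> e}" "{e \<in> H. v \<notin> e}"] assms by auto
qed

lemma card_link:
  assumes H: "triple_system V H" and v: "v \<in> V"
  shows "card {p. p \<subseteq> V - {v} \<and> card p = 2 \<and> insert v p \<in> H} = card {e \<in> H. v \<in> e}"
proof (rule bij_betw_same_card[of "insert v"], rule bij_betw_imageI)
  show "inj_on (insert v) {p. p \<subseteq> V - {v} \<and> card p = 2 \<and> insert v p \<in> H}"
    by (rule inj_onI) (metis (mono_tags, lifting) Diff_insert_absorb mem_Collect_eq subset_Diff_insert)
  show "insert v ` {p. p \<subseteq> V - {v} \<and> card p = 2 \<and> insert v p \<in> H} = {e \<in> H. v \<in> e}"
  proof (intro equalityI subsetI)
    fix e assume e: "e \<in> {e \<in> H. v \<in> e}"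
    then have "e \<subseteq> V" "card e = 3" using H by (auto simp: triple_system_def)
    then have "e - {v} \<in> {p. p \<subseteq> V - {v} \<and> card p = 2 \<and> insert v p \<in> H}"
      using e by (auto simp: insert_absorb)
    moreover have "e = insert v (e - {v})" using e by auto
    ultimately show "e \<in> insert v ` {p. p \<subseteq> V - {v} \<and> card p = 2 \<and> insert v p \<in> H}" by blast
  qed auto
qed

section \<open>Octahedra and the links of outside vertices\<close>

lemma card_complete_3partite:
  assumes "finite A" "finite B" "finite C" "A \<inter> B = {}" "A \<inter> C = {}" "B \<inter> C = {}"
  shows "card (complete_3partite A B C) = card A * card B * card C"
proof -
  have "complete_3partite A B C = (\<lambda>(a, b, c). {a, b, c}) ` (A \<times> B \<times> C)"
    unfolding complete_3partite_def by auto
  moreover have "inj_on (\<lambda>(a, b, c). {a, b, c}) (A \<times> B \<times> C)"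
  proof (rule inj_onI)
    fix s t assume st: "s \<in> A \<times> B \<times> C" "t \<in> A \<times> B \<times> C"
      and eq: "(\<lambda>(a, b, c). {a, b, c}) s = (\<lambda>(a, b, c). {a, b, c}) t"
    obtain a b c a' b' c' where s: "s = (a, b, c)" and t: "t = (a', b', c')" by (metis prod_cases3)
    have eq': "{a, b, c} = {a', b', c'}" using eq s t by simp
    have "{a, b, c} \<inter> A = {a}" "{a, b, c} \<inter> B = {b}" "{a, b, c} \<inter> C = {c}"
      "{a', b', c'} \<inter> A = {a'}" "{a', b', c'} \<inter> B = {b'}" "{a', b', c'} \<inter> C = {c'}"
      using st s t assms(4-) by auto
    then show "s = t" unfolding s t eq' by simp
  qed
  ultimately show ?thesis by (simp add: card_image card_cartesian_product)
qed

lemma complete_3partite_mem: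
  assumes "e \<subseteq> A \<union> B \<union> C" "card e = 3" "card (e \<inter> A) \<le> 1" "card (e \<inter> B) \<le> 1" "card (e \<inter> C) \<le> 1"
  shows "e \<in> complete_3partite A B C"
proof -
  have "finite e" using assms(2) by (intro card_ge_0_finite) simp
  have "e = (e \<inter> A) \<union> (e \<inter> B) \<union> (e \<inter> C)" using assms(1) by blast
  then have "card e \<le> card (e \<inter> A) + card (e \<inter> B) + card (e \<inter> C)"
    by (metis (no_types, lifting) add_le_mono1 card_Un_le le_trans)
  then have "card (e \<inter> A) = 1" "card (e \<inter> B) = 1" "card (e \<inter> C) = 1" using assms by linarith+
  then obtain a b c where abc: "e \<inter> A = {a}" "e \<inter> B = {b}" "e \<inter> C = {c}"
    by (auto simp: card_1_singleton_iff)
  then have "e = {a, b, c}" using assms(1) by blast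
  then show ?thesis using abc by (auto intro: complete_3partiteI)
qed

text \<open>The parts are two-element sets, so symmetries only permute three parameters.
  \<open>H\<close> may contain further triples and vertices, which lets outside vertices be swapped
  into a part to form a new octahedron.\<close>

locale octahedron =
  fixes H :: "'a set set" and A B C :: "'a set"
  assumes sub: "complete_3partite A B C \<subseteq> H"
    and card: "card A = 2" "card B = 2" "card C = 2"
    and disj: "A \<inter> B = {}" "A \<inter> C = {}" "B \<inter> C = {}"
begin

lemma rotate: "octahedron H B C A"
  using sub card disj complete_3partite_rotate[of A B C] by unfold_locales auto

lemma swap: "octahedron H A C B"
  using sub card disj complete_3partite_swap[of A B C] by unfold_locales auto

lemma fin: "finite A" "finite B" "finite C"
  using card by (auto intro: card_ge_0_finite)

lemma part_pair_first:
  assumes "e \<in> H" "card e = 3" "A \<subseteq> e" shows "has_berge_K4 H"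
proof -
  obtain a a' where a: "A = {a, a'}" "a \<noteq> a'" using card by (auto simp: card_2_iff)
  obtain b b' where b: "B = {b, b'}" "b \<noteq> b'" using card by (auto simp: card_2_iff)
  obtain c c' where c: "C = {c, c'}" "c \<noteq> c'" using card by (auto simp: card_2_iff)
  have "distinct [a, a', b, b', c, c']" using a b c disj by auto
  then show ?thesis
    using octahedron_part_pair[OF sub[unfolded a(1) b(1) c(1)]] assms a(1) by blast
qed

lemma transversal:
  assumes "v \<notin> A \<union> B \<union> C"
    and "p \<inter> A \<noteq> {}" "q \<inter> B \<noteq> {}" "r \<inter> C \<noteq> {}" "distinct [p, q, r]"
    and "v \<notin> p" "v \<notin> q" "v \<notin> r" "insert v p \<in> H" "insert v q \<in> H" "insert v r \<in> H"
  shows "has_berge_K4 H"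
proof -
  obtain a b c where abc: "a \<in> p" "a \<in> A" "b \<in> q" "b \<in> B" "c \<in> r" "c \<in> C" using assms by blast
  obtain a' where a: "A = {a, a'}" "a \<noteq> a'" using card abc by (auto simp: card_2_iff)
  obtain b' where b: "B = {b, b'}" "b \<noteq> b'" using card abc by (auto simp: card_2_iff)
  obtain c' where c: "C = {c, c'}" "c \<noteq> c'" using card abc by (auto simp: card_2_iff)
  have dist: "distinct [a, a', b, b', c, c', v]" using a b c disj assms(1) by auto
  have "distinct [insert v p, insert v q, insert v r]"
    using assms(5-8) by (auto dest: insert_ident[THEN iffD1, rotated 2])
  then show ?thesis
    by (rule octahedron_transversal[OF sub[unfolded a(1) b(1) c(1)] dist assms(9-11)])
      (use abc in auto)
qed

lemma part_pair:
  assumes "e \<in> H" "card e = 3" "A \<subseteq> e \<or> B \<subseteq> e \<or> C \<subseteq> e" shows "has_berge_K4 H"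
  using assms part_pair_first octahedron.part_pair_first[OF rotate]
    octahedron.part_pair_first[OF octahedron.rotate[OF rotate]] by blast

lemma not_part_pair:
  assumes "finite e" "\<not> A \<subseteq> e" shows "card (e \<inter> A) \<le> 1"
proof -
  have "card (e \<inter> A) < card A" using assms fin by (intro psubset_card_mono) auto
  then show ?thesis using card by simp
qed

text \<open>A triple containing no part has at most one point in each of the three parts, hence is a
  transversal already present.\<close>

lemma extra_triple:
  assumes "e \<in> H" "e \<subseteq> A \<union> B \<union> C" "card e = 3" "e \<notin> complete_3partite A B C"
  shows "has_berge_K4 H"
proof (rule ccontr)
  assume "\<not> ?thesis"
  then have no: "\<not> A \<subseteq> e" "\<not> B \<subseteq> e" "\<not> C \<subseteq> e" using part_pair assms by blast+
  have "finite e" using assms by (intro card_ge_0_finite) simp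
  then have "card (e \<inter> A) \<le> 1" "card (e \<inter> B) \<le> 1" "card (e \<inter> C) \<le> 1"
    using not_part_pair no octahedron.not_part_pair[OF rotate]
      octahedron.not_part_pair[OF octahedron.rotate[OF rotate]] by auto
  then show False using complete_3partite_mem assms by blast
qed

lemma card_complete: "card (complete_3partite A B C) = 8"
  using card_complete_3partite[OF fin disj] card by simp

text \<open>A link edge meets exactly two parts, as otherwise it would be a part. So each of three
  distinct link edges meets at least one of any two parts, and Hall's condition for assigning the
  edges to the parts fails only if some part is missed by all of them. An assignment would be the
  situation of \<open>transversal\<close>.\<close>

lemma link:
  assumes free: "B_free H" and v: "v \<notin> A \<union> B \<union> C"
    and L: "L = {p. p \<subseteq> A \<union> B \<union> C \<and> card p = 2 \<and> insert v p \<in> H}" "3 \<le> card L"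
  shows "(\<forall>p \<in> L. p \<inter> A = {}) \<or> (\<forall>p \<in> L. p \<inter> B = {}) \<or> (\<forall>p \<in> L. p \<inter> C = {})"
proof -
  have nb: "\<not> has_berge_K4 H" using free by (simp add: B_free_def)
  have v': "v \<notin> p" if "p \<in> L" for p using that v L by auto
  have two: "(p \<inter> A \<noteq> {} \<and> p \<inter> B \<noteq> {}) \<or> (p \<inter> A \<noteq> {} \<and> p \<inter> C \<noteq> {}) \<or> (p \<inter> B \<noteq> {} \<and> p \<inter> C \<noteq> {})"
    if p: "p \<in> L" for p
  proof (rule ccontr)
    assume "\<not> ?thesis"
    then have "p \<subseteq> A \<or> p \<subseteq> B \<or> p \<subseteq> C" using p L by blast
    then have "p = A \<or> p = B \<or> p = C" using p L card fin card_subset_eq by (metis (mono_tags, lifting) mem_Collect_eq)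
    moreover have "card p = 2" using p L(1) by simp
    then have "finite p" "card p = 2" by (auto intro: card_ge_0_finite)
    then have "card (insert v p) = 3" using v'[OF p] by simp
    ultimately show False using part_pair[of "insert v p"] p L nb by auto
  qed
  have tr: "\<not> (distinct [p, q, r] \<and> p \<inter> A \<noteq> {} \<and> q \<inter> B \<noteq> {} \<and> r \<inter> C \<noteq> {})"
    if "p \<in> L" "q \<in> L" "r \<in> L" for p q r
    using transversal[OF v, of p q r] that v' L nb by blast
  show ?thesis
  proof (rule ccontr)
    assume "\<not> ?thesis"
    then obtain x y z where xyz: "x \<in> L" "x \<inter> A \<noteq> {}" "y \<in> L" "y \<inter> B \<noteq> {}" "z \<in> L" "z \<inter> C \<noteq> {}" by blast
    have "\<exists>w \<in> L. w \<noteq> p \<and> w \<noteq> q" for p q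
    proof (rule ccontr)
      assume "\<not> ?thesis"
      then have "L \<subseteq> {p, q}" by blast
      then have "card L \<le> card {p, q}" by (intro card_mono) auto
      also have "\<dots> \<le> 2" by (simp add: card_insert_if)
      finally show False using L by simp
    qed
    then obtain w where w: "w p q \<in> L" "w p q \<noteq> p" "w p q \<noteq> q" for p q by metis
    \<comment> \<open>The witnesses for the three parts may coincide; they are filled up to three
      distinct edges.\<close>
    have "\<exists>p q r. distinct [p, q, r] \<and> {p, q, r} \<subseteq> L \<and> {x, y, z} \<subseteq> {p, q, r}"
    proof (cases "distinct [x, y, z]")
      case True
      then show ?thesis using xyz by blast
    next
      case False
      then obtain s t where "s \<in> L" "t \<in> L" "s \<noteq> t" "{x, y, z} \<subseteq> {s, t}"
        using xyz w[of x x] by (cases "x = y"; cases "x = z") auto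
      then show ?thesis using w[of s t] by (intro exI[of _ s] exI[of _ t] exI[of _ "w s t"]) auto
    qed
    then obtain p q r where pqr: "distinct [p, q, r]" "p \<in> L" "q \<in> L" "r \<in> L" "{x, y, z} \<subseteq> {p, q, r}"
      by auto
    have "p \<inter> A = {} \<and> q \<inter> A = {} \<and> r \<inter> A = {} \<or> p \<inter> B = {} \<and> q \<inter> B = {} \<and> r \<inter> B = {} \<or>
        p \<inter> C = {} \<and> q \<inter> C = {} \<and> r \<inter> C = {}"
      using two[OF pqr(2)] two[OF pqr(3)] two[OF pqr(4)] pqr(1)
        tr[OF pqr(2,3,4)] tr[OF pqr(2,4,3)] tr[OF pqr(3,2,4)] tr[OF pqr(3,4,2)]
        tr[OF pqr(4,2,3)] tr[OF pqr(4,3,2)] by (simp del: disjoint_iff) argo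
    then show False using pqr(5) xyz by auto
  qed
qed

end

lemma card_pairs_between_le:
  assumes "finite X" "finite Y" shows "card {{x, y} | x y. x \<in> X \<and> y \<in> Y} \<le> card X * card Y"
proof -
  have "{{x, y} | x y. x \<in> X \<and> y \<in> Y} = (\<lambda>(x, y). {x, y}) ` (X \<times> Y)" by auto
  then show ?thesis using card_image_le[of "X \<times> Y" "\<lambda>(x, y). {x, y}"] assms
    by (simp add: card_cartesian_product)
qed

lemma pair_between:
  assumes "p \<subseteq> X \<union> Y" "card p = 2" "card (p \<inter> X) \<le> 1" "card (p \<inter> Y) \<le> 1"
  shows "p \<in> {{x, y} | x y. x \<in> X \<and> y \<in> Y}"
proof -
  have "p = (p \<inter> X) \<union> (p \<inter> Y)" using assms(1) by blast
  then have "card p \<le> card (p \<inter> X) + card (p \<inter> Y)" by (metis card_Un_le)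
  then have "card (p \<inter> X) = 1" "card (p \<inter> Y) = 1" using assms by linarith+
  then obtain x y where "p \<inter> X = {x}" "p \<inter> Y = {y}" by (auto simp: card_1_singleton_iff)
  moreover from this have "p = {x, y}" using assms(1) by blast
  ultimately show ?thesis by blast
qed

context octahedron
begin

lemma mem: "a \<in> A \<Longrightarrow> b \<in> B \<Longrightarrow> c \<in> C \<Longrightarrow> {a, b, c} \<in> H"
  by (rule subsetD[OF sub complete_3partiteI])

lemma link_between_first:
  assumes free: "B_free H" and v: "v \<notin> A \<union> B \<union> C"
    and L: "L = {p. p \<subseteq> A \<union> B \<union> C \<and> card p = 2 \<and> insert v p \<in> H}"
    and C: "\<forall>p \<in> L. p \<inter> C = {}"
  shows "L \<subseteq> {{x, y} | x y. x \<in> A \<and> y \<in> B}"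
proof
  fix p assume p: "p \<in> L"
  have p': "p \<subseteq> A \<union> B" "card p = 2" "insert v p \<in> H" "v \<notin> p" using p C L v by auto
  have fin_p: "finite p" using p'(2) by (intro card_ge_0_finite) simp
  have "card (insert v p) = 3" using p' fin_p by simp
  then have "\<not> A \<subseteq> insert v p" "\<not> B \<subseteq> insert v p"
    using part_pair[OF p'(3)] free by (auto simp: B_free_def)
  then have "card (p \<inter> A) \<le> 1" "card (p \<inter> B) \<le> 1"
    using not_part_pair[OF fin_p] octahedron.not_part_pair[OF rotate fin_p] by blast+
  then show "p \<in> {{x, y} | x y. x \<in> A \<and> y \<in> B}" by (rule pair_between[OF p'(1,2)])
qed

lemma link_between:
  assumes free: "B_free H" and v: "v \<notin> A \<union> B \<union> C"
    and L: "L = {p. p \<subseteq> A \<union> B \<union> C \<and> card p = 2 \<and> insert v p \<in> H}" "3 \<le> card L"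
  shows "\<exists>X Y Z. octahedron H X Y Z \<and> X \<union> Y \<union> Z = A \<union> B \<union> C \<and> (X, Y) \<in> {(A, B), (B, C), (C, A)} \<and>
    L \<subseteq> {{x, y} | x y. x \<in> X \<and> y \<in> Y}"
proof -
  consider "\<forall>p \<in> L. p \<inter> A = {}" | "\<forall>p \<in> L. p \<inter> B = {}" | "\<forall>p \<in> L. p \<inter> C = {}"
    using link[OF assms] by blast
  then show ?thesis
  proof cases
    case 1
    then have "L \<subseteq> {{x, y} | x y. x \<in> B \<and> y \<in> C}"
      by (intro octahedron.link_between_first[OF rotate free]) (use v L in auto)
    then show ?thesis using rotate by blast
  next
    case 2
    then have "L \<subseteq> {{x, y} | x y. x \<in> C \<and> y \<in> A}"
      by (intro octahedron.link_between_first[OF octahedron.rotate[OF rotate] free]) (use v L in auto)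
    then show ?thesis using octahedron.rotate[OF rotate] by blast
  next
    case 3
    then show ?thesis using link_between_first[OF free v L(1)] octahedron_axioms by blast
  qed
qed

lemma card_link_le:
  assumes free: "B_free H" and v: "v \<notin> A \<union> B \<union> C"
  shows "card {p. p \<subseteq> A \<union> B \<union> C \<and> card p = 2 \<and> insert v p \<in> H} \<le> 4" (is "card ?L \<le> 4")
proof (cases "3 \<le> card ?L")
  case True
  then obtain X Y Z where XYZ: "octahedron H X Y Z" and L: "?L \<subseteq> {{x, y} | x y. x \<in> X \<and> y \<in> Y}"
    using link_between[OF free v refl] by blast
  note fins = octahedron.fin[OF XYZ]
  have "{{x, y} | x y. x \<in> X \<and> y \<in> Y} = (\<lambda>(x, y). {x, y}) ` (X \<times> Y)" by auto
  then have "finite {{x, y} | x y. x \<in> X \<and> y \<in> Y}" using fins by simp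
  then have "card ?L \<le> card X * card Y"
    using card_mono[OF _ L] card_pairs_between_le[OF fins(1,2)] by linarith
  then show ?thesis using octahedron.card[OF XYZ] by simp
qed simp

text \<open>Four link edges must exhaust the 2 * 2 pairs between two parts, so \<open>v\<close>
  behaves like a third point of the remaining part.\<close>

lemma joined:
  assumes free: "B_free H" and v: "v \<notin> A \<union> B \<union> C"
    and L: "4 \<le> card {p. p \<subseteq> A \<union> B \<union> C \<and> card p = 2 \<and> insert v p \<in> H}" (is "4 \<le> card ?L")
  shows "(\<forall>x \<in> A. \<forall>y \<in> B. {v, x, y} \<in> H) \<or> (\<forall>x \<in> B. \<forall>y \<in> C. {v, x, y} \<in> H) \<or>
    (\<forall>x \<in> C. \<forall>y \<in> A. {v, x, y} \<in> H)"
proof -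
  have "3 \<le> card ?L" using L by simp
  from link_between[OF free v refl this] obtain X Y Z
    where XYZ: "octahedron H X Y Z" "(X, Y) \<in> {(A, B), (B, C), (C, A)}"
      and sub: "?L \<subseteq> {{x, y} | x y. x \<in> X \<and> y \<in> Y}" by blast
  note fins = octahedron.fin[OF XYZ(1)]
  have "{{x, y} | x y. x \<in> X \<and> y \<in> Y} = (\<lambda>(x, y). {x, y}) ` (X \<times> Y)" by auto
  then have "finite {{x, y} | x y. x \<in> X \<and> y \<in> Y}" using fins by simp
  moreover have "card {{x, y} | x y. x \<in> X \<and> y \<in> Y} \<le> card ?L"
    using card_pairs_between_le[OF fins(1,2)] octahedron.card[OF XYZ(1)] L by simp
  ultimately have eq: "?L = {{x, y} | x y. x \<in> X \<and> y \<in> Y}" using sub by (intro card_seteq)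
  have "{v, x, y} \<in> H" if "x \<in> X" "y \<in> Y" for x y
  proof -
    have "{x, y} \<in> ?L" unfolding eq using that by blast
    then show ?thesis by simp
  qed
  then show ?thesis using XYZ(2) by auto
qed

text \<open>Here \<open>u\<close> can replace a point of \<open>C\<close>, and \<open>v\<close> a
  point of \<open>C\<close> or of \<open>A\<close>. If both fit into \<open>C\<close>, then
  \<open>u, v\<close> is a part of a new octahedron; otherwise \<open>x, v\<close> or
  \<open>x, u\<close> is one, according to whether \<open>x\<close> lies in \<open>A\<close> or
  \<open>C\<close>. In each case \<open>{u, v, x}\<close> contains a part.\<close>

lemma two_joined_first:
  assumes uv: "u \<noteq> v" "u \<notin> A \<union> B \<union> C" "v \<notin> A \<union> B \<union> C"
    and u: "\<forall>x \<in> A. \<forall>y \<in> B. {u, x, y} \<in> H"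
    and v: "(\<forall>x \<in> A. \<forall>y \<in> B. {v, x, y} \<in> H) \<or> (\<forall>x \<in> B. \<forall>y \<in> C. {v, x, y} \<in> H)"
    and x: "x \<in> A \<union> C" "{u, v, x} \<in> H"
  shows "has_berge_K4 H"
proof -
  have xuv: "x \<noteq> u" "x \<noteq> v" using uv x by auto
  then have c3: "card {u, v, x} = 3" using uv(1) by simp
  show ?thesis
    using v
  proof
    assume v: "\<forall>x \<in> A. \<forall>y \<in> B. {v, x, y} \<in> H"
    have "complete_3partite A B {u, v} \<subseteq> H"
      using u v by (auto simp: complete_3partite_def insert_commute)
    then have "octahedron H A B {u, v}"
      using card disj uv by unfold_locales auto
    then show ?thesis using octahedron.part_pair[of H A B "{u, v}" "{u, v, x}"] x c3 by auto
  next
    assume v: "\<forall>x \<in> B. \<forall>y \<in> C. {v, x, y} \<in> H"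
    from x(1) show ?thesis
    proof
      assume xA: "x \<in> A"
      have "complete_3partite {x, v} B C \<subseteq> H"
        using v mem[OF xA] by (auto simp: complete_3partite_def insert_commute)
      then have "octahedron H {x, v} B C"
        using card disj uv xA xuv by unfold_locales auto
      then show ?thesis using octahedron.part_pair[of H "{x, v}" B C "{u, v, x}"] x c3 by auto
    next
      assume xC: "x \<in> C"
      have "complete_3partite A B {x, u} \<subseteq> H"
        using u mem[OF _ _ xC] by (auto simp: complete_3partite_def insert_commute)
      then have "octahedron H A B {x, u}"
        using card disj uv xC xuv by unfold_locales auto
      then show ?thesis using octahedron.part_pair[of H A B "{x, u}" "{u, v, x}"] x c3 by auto
    qed
  qed
qed

lemma two_joined:
  assumes uv: "u \<noteq> v" "u \<notin> A \<union> B \<union> C" "v \<notin> A \<union> B \<union> C"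
    and u: "\<forall>x \<in> A. \<forall>y \<in> B. {u, x, y} \<in> H"
    and v: "(\<forall>x \<in> A. \<forall>y \<in> B. {v, x, y} \<in> H) \<or> (\<forall>x \<in> B. \<forall>y \<in> C. {v, x, y} \<in> H) \<or>
      (\<forall>x \<in> C. \<forall>y \<in> A. {v, x, y} \<in> H)"
    and x: "3 \<le> card {x \<in> A \<union> B \<union> C. {u, v, x} \<in> H}"
  shows "has_berge_K4 H"
proof -
  let ?X = "{x \<in> A \<union> B \<union> C. {u, v, x} \<in> H}"
  \<comment> \<open>Only third points in one particular part are useless, and a part has two points;
    this is why three are demanded.\<close>
  have nsub: "\<not> ?X \<subseteq> Y" if "card Y = 2" "finite Y" for Y
    using card_mono[OF that(2), of ?X] x that(1) by auto
  consider "(\<forall>x \<in> A. \<forall>y \<in> B. {v, x, y} \<in> H) \<or> (\<forall>x \<in> B. \<forall>y \<in> C. {v, x, y} \<in> H)"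
    | "\<forall>x \<in> C. \<forall>y \<in> A. {v, x, y} \<in> H"
    using v by blast
  then show ?thesis
  proof cases
    case 1
    obtain x where "x \<in> A \<union> C" "{u, v, x} \<in> H" using nsub[OF card(2) fin(2)] by auto
    then show ?thesis using two_joined_first[OF uv u 1] by blast
  next
    case 2
    then have v': "\<forall>x \<in> A. \<forall>y \<in> C. {v, x, y} \<in> H" by (metis insert_commute)
    obtain x where x: "x \<in> B \<union> C" "{u, v, x} \<in> H" using nsub[OF card(1) fin(1)] by auto
    have "octahedron H B A C" using octahedron.swap[OF rotate] .
    moreover have "\<forall>x \<in> B. \<forall>y \<in> A. {u, x, y} \<in> H" using u by (metis insert_commute)
    ultimately show ?thesis
      using octahedron.two_joined_first[of H B A C u v x] uv v' x by auto
  qed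
qed

end


section \<open>Double complete systems and the links of outside vertices\<close>

lemma card_3_subset_of_4:
  assumes "e \<subseteq> {a, b, c, d}" "card e = 3" "distinct [a, b, c, d]"
  shows "e \<in> {{a, b, c}, {a, b, d}, {a, c, d}, {b, c, d}}"
proof -
  have "card ({a, b, c, d} - e) = 1"
    using assms by (simp add: card_Diff_subset finite_subset)
  then obtain x where x: "{a, b, c, d} - e = {x}" by (auto simp: card_1_singleton_iff)
  then have "e = {a, b, c, d} - {x}" "x \<in> {a, b, c, d}" using assms(1) by blast+
  then show ?thesis using assms(3) by (auto simp: insert_Diff_if)
qed

text \<open>The names picture \<open>a, a'\<close> as a spine with pages \<open>b, b'\<close> and
  \<open>c, c'\<close>. The spine cannot be exchanged with a page, so the symmetries are the swaps
  inside each pair and the exchange of the pages.\<close>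

locale double_K4_system =
  fixes H :: "'a set set" and a a' b b' c c' :: 'a
  assumes sub: "double_K4 a a' b b' c c' \<subseteq> H" and dist: "distinct [a, a', b, b', c, c']"
begin

lemma swap_spine: "double_K4_system H a' a b b' c c'"
  using sub dist double_K4_swap(1)[of a a' b b' c c'] by unfold_locales auto

lemma swap_page: "double_K4_system H a a' b' b c c'"
  using sub dist double_K4_swap(2)[of a a' b b' c c'] by unfold_locales auto

lemma swap_pages: "double_K4_system H a a' c c' b b'"
  using sub dist double_K4_swap(3)[of a a' b b' c c'] by unfold_locales auto

lemma swap_page': "double_K4_system H a a' b b' c' c"
  by (rule double_K4_system.swap_pages, rule double_K4_system.swap_page, rule swap_pages)

lemma cross_pair_first:
  assumes "e \<in> H" "card e = 3" "{b, c} \<subseteq> e" shows "has_berge_K4 H"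
proof -
  have "b \<noteq> c" using dist by simp
  then obtain x where "e = {b, c, x}" "x \<notin> {b, c}" using triple_third[OF assms(2,3)] by blast
  then show ?thesis using double_K4_cross_pair[OF sub dist] assms(1) by blast
qed

lemma cross_pair:
  assumes "e \<in> H" "card e = 3" "x \<in> e" "x \<in> {b, b'}" "y \<in> e" "y \<in> {c, c'}" shows "has_berge_K4 H"
  using assms cross_pair_first double_K4_system.cross_pair_first[OF swap_page]
    double_K4_system.cross_pair_first[OF swap_page']
    double_K4_system.cross_pair_first[OF double_K4_system.swap_page'[OF swap_page]]
  by auto

text \<open>A triple without points on both pages lies in one of the two four-point sets, all of
  whose triples are already present.\<close>

lemma extra_triple:
  assumes e: "e \<in> H" "card e = 3" "e \<subseteq> {a, a', b, b', c, c'}" "e \<notin> double_K4 a a' b b' c c'"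
  shows "has_berge_K4 H"
proof (rule ccontr)
  assume "\<not> ?thesis"
  then have "e \<inter> {b, b'} = {} \<or> e \<inter> {c, c'} = {}" using cross_pair[OF e(1,2)] by blast
  then have "e \<subseteq> {a, a', b, b'} \<or> e \<subseteq> {a, a', c, c'}" using e(3) by blast
  moreover have "distinct [a, a', b, b']" "distinct [a, a', c, c']" using dist by auto
  ultimately have "e \<in> {{a, a', b}, {a, a', b'}, {a, b, b'}, {a', b, b'}} \<or>
      e \<in> {{a, a', c}, {a, a', c'}, {a, c, c'}, {a', c, c'}}"
    using card_3_subset_of_4 e(2) by metis
  moreover have "{{a, a', b}, {a, a', b'}, {a, b, b'}, {a', b, b'}} \<subseteq> double_K4 a a' b b' c c'"
    "{{a, a', c}, {a, a', c'}, {a, c, c'}, {a', c, c'}} \<subseteq> double_K4 a a' b b' c c'"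
    by (simp_all add: double_K4_def)
  ultimately have "e \<in> double_K4 a a' b b' c c'" by (meson subsetD)
  then show False using e(4) by simp
qed

lemma link_pair_at_page_aux:
  assumes v: "v \<notin> {a, a', b, b', c, c'}" and p: "p \<in> {{a, b}, {b, b'}}" "insert v p \<in> H"
  shows "has_berge_K4 H"
  using p
proof (elim insertE)
  assume "p = {a, b}"
  then have "{a, b, v} \<in> H" using p by (simp add: insert_commute)
  then show ?thesis using double_K4_mixed_pair[OF sub dist] v by blast
next
  assume "p = {b, b'}"
  then have "{b, b', v} \<in> H" using p by (simp add: insert_commute)
  then show ?thesis using double_K4_page_pair[OF sub dist] v by blast
qed simp

lemma link_pair_at_page:
  assumes v: "v \<notin> {a, a', b, b', c, c'}" and p: "x \<in> {a, a', b'}" "insert v {x, b} \<in> H"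
  shows "has_berge_K4 H"
proof -
  consider "x = a" | "x = a'" | "x = b'" using p by blast
  then show ?thesis
  proof cases
    case 1
    then show ?thesis using link_pair_at_page_aux[OF v, of "{a, b}"] p by simp
  next
    case 2
    then show ?thesis using double_K4_system.link_pair_at_page_aux[OF swap_spine, of v "{a', b}"] p v by simp
  next
    case 3
    then show ?thesis using link_pair_at_page_aux[OF v, of "{b, b'}"] p by (simp add: insert_commute)
  qed
qed

lemma link_pair:
  assumes v: "v \<notin> {a, a', b, b', c, c'}" and p: "x \<in> {a, a', b, b'}" "y \<in> {b, b'}" "x \<noteq> y" "insert v {x, y} \<in> H"
  shows "has_berge_K4 H"
proof (cases "y = b")
  case True
  then show ?thesis using link_pair_at_page[OF v, of x] p by auto
next
  case False
  then show ?thesis using double_K4_system.link_pair_at_page[OF swap_page, of v x] p v by auto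
qed

text \<open>Any pair other than the spine has a point on a page. Its other point is either on the
  opposite page, which gives a cross pair, or in the same four-point set, which is excluded by
  \<open>link_pair\<close>.\<close>

lemma link:
  assumes free: "B_free H" and v: "v \<notin> {a, a', b, b', c, c'}"
    and p: "p \<subseteq> {a, a', b, b', c, c'}" "card p = 2" "insert v p \<in> H"
  shows "p = {a, a'}"
proof (rule ccontr)
  assume ne: "p \<noteq> {a, a'}"
  obtain x y where xy: "p = {x, y}" "x \<noteq> y" using p(2) by (auto simp: card_2_iff)
  have "\<not> p \<subseteq> {a, a'}"
  proof
    assume "p \<subseteq> {a, a'}"
    then have "p = {a, a'}" using p(2) dist by (intro card_subset_eq) auto
    then show False using ne by simp
  qed
  then have "\<exists>y \<in> {b, b', c, c'}. \<exists>x. p = {x, y} \<and> x \<noteq> y"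
    using p(1) xy by auto
  then obtain x y where xy: "y \<in> {b, b', c, c'}" "p = {x, y}" "x \<noteq> y" by blast
  have "x \<in> {a, a', b, b', c, c'}" using xy p(1) by simp
  then consider "x \<in> {a, a', b, b'}" "y \<in> {b, b'}" | "x \<in> {a, a', c, c'}" "y \<in> {c, c'}"
    | "x \<in> {b, b'}" "y \<in> {c, c'}" | "y \<in> {b, b'}" "x \<in> {c, c'}"
    using xy(1) by blast
  then have "has_berge_K4 H"
  proof cases
    case 1
    then show ?thesis using link_pair[OF v _ _ xy(3)] p xy by simp
  next
    case 2
    then show ?thesis using double_K4_system.link_pair[OF swap_pages _ _ _ xy(3), of v] v p xy by simp
  next
    case 3
    have "card (insert v p) = 3" using p v xy by auto
    then show ?thesis using cross_pair[OF p(3), of x y] 3 xy by simp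
  next
    case 4
    have "card (insert v p) = 3" using p v xy by auto
    then show ?thesis using cross_pair[OF p(3), of y x] 4 xy by simp
  qed
  then show False using free by (simp add: B_free_def)
qed

lemma card_link_le:
  assumes free: "B_free H" and v: "v \<notin> {a, a', b, b', c, c'}"
  shows "card {p. p \<subseteq> {a, a', b, b', c, c'} \<and> card p = 2 \<and> insert v p \<in> H} \<le> 1"
proof -
  have "{p. p \<subseteq> {a, a', b, b', c, c'} \<and> card p = 2 \<and> insert v p \<in> H} \<subseteq> {{a, a'}}"
    using link[OF free v] by blast
  from card_mono[OF _ this] show ?thesis by simp
qed

lemma card_double_K4_le: "card (double_K4 a a' b b' c c') \<le> 8"
proof -
  have "double_K4 a a' b b' c c' = set [{a, a', b}, {a, a', b'}, {a, b, b'}, {a', b, b'},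
      {a, a', c}, {a, a', c'}, {a, c, c'}, {a', c, c'}]"
    by (simp add: double_K4_def)
  also have "card \<dots> \<le> length [{a, a', b}, {a, a', b'}, {a, b, b'}, {a', b, b'},
      {a, a', c}, {a, a', c'}, {a, c, c'}, {a', c, c'}]"
    by (rule card_length)
  finally show ?thesis by simp
qed

end

lemma six_points_cases:
  assumes "triple_system V H" "card V = 6" "B_free H" "8 \<le> card H"
  obtains (oct) A B C where "octahedron H A B C" "V = A \<union> B \<union> C"
    | (double) a a' b b' c c' where "double_K4_system H a a' b b' c c'" "V = {a, a', b, b', c, c'}"
proof -
  obtain a a' b b' c c' where dist: "distinct [a, a', b, b', c, c']" and V: "V = {a, a', b, b', c, c'}"
    and "complete_3partite {a, a'} {b, b'} {c, c'} \<subseteq> H \<or> double_K4 a a' b b' c c' \<subseteq> H"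
    using six_points[OF assms] by blast
  then show thesis
  proof (elim disjE)
    assume "complete_3partite {a, a'} {b, b'} {c, c'} \<subseteq> H"
    then have "octahedron H {a, a'} {b, b'} {c, c'}" using dist by unfold_locales auto
    then show thesis by (rule oct) (use V in auto)
  next
    assume "double_K4 a a' b b' c c' \<subseteq> H"
    then have "double_K4_system H a a' b b' c c'" using dist by unfold_locales auto
    then show thesis by (rule double) (rule V)
  qed
qed

subsection \<open>Six, seven and eight points\<close>

lemma octahedron_mono: "octahedron H A B C \<Longrightarrow> H \<subseteq> H' \<Longrightarrow> octahedron H' A B C"
  unfolding octahedron_def by (meson order_trans)

lemma double_K4_system_mono: "double_K4_system H a a' b b' c c' \<Longrightarrow> H \<subseteq> H' \<Longrightarrow> double_K4_system H' a a' b b' c c'"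
  unfolding double_K4_system_def by (meson order_trans)

lemma six_bound:
  assumes H: "triple_system V H" and V: "card V = 6" and free: "B_free H"
  shows "card H \<le> 8"
proof (rule ccontr)
  assume "\<not> ?thesis"
  then have c: "8 < card H" by simp
  have e3: "card e = 3" "e \<subseteq> V" if "e \<in> H" for e using H that by (auto simp: triple_system_def)
  have nsub: "\<exists>e \<in> H. e \<notin> X" if "card X \<le> 8" "finite X" for X
  proof (rule ccontr)
    assume "\<not> ?thesis"
    then have "card H \<le> card X" using that by (intro card_mono) auto
    then show False using c that by simp
  qed
  show False
    using H V free less_imp_le[OF c]
  proof (cases rule: six_points_cases)
    case (oct A B C)
    interpret octahedron H A B C by fact
    have "finite (complete_3partite A B C)" using card_complete by (intro card_ge_0_finite) simp
    then obtain e where "e \<in> H" "e \<notin> complete_3partite A B C" using nsub card_complete by force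
    then show False using extra_triple[of e] e3 oct free by (auto simp: B_free_def)
  next
    case (double a a' b b' c c')
    interpret double_K4_system H a a' b b' c c' by fact
    have "finite (double_K4 a a' b b' c c')" by (simp add: double_K4_def)
    then obtain e where "e \<in> H" "e \<notin> double_K4 a a' b b' c c'" using nsub card_double_K4_le by blast
    then show False using extra_triple[of e] e3[of e] double free unfolding B_free_def by blast
  qed
qed

lemma seven_point_degree:
  assumes H: "triple_system V H" and V: "card V = 7" and free: "B_free H" and v: "v \<in> V"
    and c: "8 \<le> card {e \<in> H. v \<notin> e}"
  shows "card {e \<in> H. v \<in> e} \<le> 4"
proof -
  have "finite V" using V by (intro card_ge_0_finite) simp
  then have cV: "card (V - {v}) = 6" using V v by simp
  have free': "B_free {e \<in> H. v \<notin> e}" using free by (rule B_free_subset) auto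
  have sub: "{e \<in> H. v \<notin> e} \<subseteq> H" by auto
  show ?thesis
    using triple_system_delete[OF H] cV free' c
  proof (cases rule: six_points_cases)
    case (oct A B C)
    interpret H: octahedron H A B C using oct(1) sub by (rule octahedron_mono)
    have "v \<notin> A \<union> B \<union> C" using oct(2) by blast
    from H.card_link_le[OF free this] show ?thesis using card_link[OF H v] unfolding oct(2) by simp
  next
    case (double a a' b b' c c')
    interpret H: double_K4_system H a a' b b' c c' using double(1) sub by (rule double_K4_system_mono)
    have "v \<notin> {a, a', b, b', c, c'}" using double(2) by blast
    from H.card_link_le[OF free this] show ?thesis using card_link[OF H v] unfolding double(2) by simp
  qed
qed

lemma seven_bound:
  assumes H: "triple_system V H" and V: "card V = 7" and free: "B_free H"
  shows "card H \<le> 12"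
proof (rule ccontr)
  assume "\<not> ?thesis"
  then have "13 \<le> card H" by simp
  then obtain H' where H': "H' \<subseteq> H" "card H' = 13" by (meson obtain_subset_with_card_n)
  have fin: "finite V" using V by (intro card_ge_0_finite) simp
  have T: "triple_system V H'" using H H'(1) by (rule triple_system_subset)
  have F: "B_free H'" using free H'(1) by (rule B_free_subset)
  have finH: "finite H'" using triple_system_finite[OF T fin] .
  \<comment> \<open>The degrees sum to 39, which is less than 7 * 6.\<close>
  have "\<exists>v \<in> V. card {e \<in> H'. v \<in> e} \<le> 5"
  proof (rule ccontr)
    assume "\<not> ?thesis"
    then have "(\<Sum>v \<in> V. 6) \<le> (\<Sum>v \<in> V. card {e \<in> H'. v \<in> e})" by (intro sum_mono) auto
    then show False using sum_degrees[OF T fin] V H'(2) by simp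
  qed
  then obtain v where v: "v \<in> V" "card {e \<in> H'. v \<in> e} \<le> 5" by blast
  have split: "13 = card {e \<in> H'. v \<in> e} + card {e \<in> H'. v \<notin> e}"
    using card_split_vertex[OF finH, of v] H'(2) by simp
  have "card {e \<in> H'. v \<notin> e} \<le> 8"
  proof (rule six_bound)
    show "triple_system (V - {v}) {e \<in> H'. v \<notin> e}" using T by (rule triple_system_delete)
    show "card (V - {v}) = 6" using V v fin by simp
    show "B_free {e \<in> H'. v \<notin> e}" using F by (rule B_free_subset) auto
  qed
  \<comment> \<open>Degree at most five leaves at least eight triples on the other six points. Then
    the degree is even at most four, which leaves nine, one too many.\<close>
  then show False using seven_point_degree[OF T V F v(1)] v split by simp
qed

text \<open>Codegree three makes every bound tight: of the 12 triples avoiding \<open>u\<close> at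
  most 7 - 3 contain \<open>v\<close> and at most eight lie on the other six points. So these points
  carry one of the two eight-triple systems, in which \<open>u\<close> and \<open>v\<close> each
  have four link edges. This rules out a double \<open>K_4\<close> and joins both vertices to an
  octahedron, with three common third points for \<open>two_joined\<close>.\<close>

lemma eight_point_pair:
  assumes H: "triple_system V H" and V: "card V = 8" and free: "B_free H" and cH: "card H = 19"
    and uv: "u \<in> V" "v \<in> V" "u \<noteq> v"
    and deg: "card {e \<in> H. u \<in> e} = 7" "card {e \<in> H. v \<in> e} = 7"
  shows "card {e \<in> H. {u, v} \<subseteq> e} \<le> 2"
proof (rule ccontr)
  assume "\<not> ?thesis"
  then have cod: "3 \<le> card {e \<in> H. {u, v} \<subseteq> e}" by simp
  have fin: "finite V" using V by (intro card_ge_0_finite) simp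
  have finH: "finite H" using triple_system_finite[OF H fin] .
  let ?Hu = "{e \<in> H. u \<notin> e}" and ?Hv = "{e \<in> H. v \<notin> e}"
  let ?K = "{e \<in> ?Hu. v \<notin> e}"
  have K': "{e \<in> ?Hv. u \<notin> e} = ?K" by auto
  have cHu: "card ?Hu = 12" "card ?Hv = 12"
    using card_split_vertex[OF finH, of u] card_split_vertex[OF finH, of v] deg cH by auto
  have "{e \<in> {e \<in> H. v \<in> e}. u \<in> e} = {e \<in> H. {u, v} \<subseteq> e}" "{e \<in> {e \<in> H. v \<in> e}. u \<notin> e} = {e \<in> ?Hu. v \<in> e}"
    "{e \<in> {e \<in> H. u \<in> e}. v \<in> e} = {e \<in> H. {u, v} \<subseteq> e}" "{e \<in> {e \<in> H. u \<in> e}. v \<notin> e} = {e \<in> ?Hv. u \<in> e}"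
    by auto
  then have split: "7 = card {e \<in> H. {u, v} \<subseteq> e} + card {e \<in> ?Hu. v \<in> e}"
      "7 = card {e \<in> H. {u, v} \<subseteq> e} + card {e \<in> ?Hv. u \<in> e}"
    using card_split_vertex[of "{e \<in> H. v \<in> e}" u] card_split_vertex[of "{e \<in> H. u \<in> e}" v] finH deg by auto
  have splitK: "12 = card {e \<in> ?Hu. v \<in> e} + card ?K"
    using card_split_vertex[of ?Hu v] finH cHu by simp
  have T: "triple_system (V - {u}) ?Hu" "triple_system (V - {v}) ?Hv"
    using H by (auto intro: triple_system_delete)
  have TK: "triple_system (V - {u} - {v}) ?K" using T(1) by (rule triple_system_delete)
  have cV: "card (V - {u} - {v}) = 6" using V uv fin by simp
  have FK: "B_free ?K" using free by (rule B_free_subset) auto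
  have "card ?K \<le> 8" using six_bound[OF TK cV FK] .
  then have four: "card {e \<in> ?Hu. v \<in> e} = 4" "card {e \<in> ?Hv. u \<in> e} = 4" and eight: "8 \<le> card ?K"
    using split splitK cod by linarith+
  have sub: "?K \<subseteq> H" by auto
  have Vuv: "V - {u} - {v} = V - {v} - {u}" by auto
  have link: "card {p. p \<subseteq> V - {u} - {v} \<and> card p = 2 \<and> insert v p \<in> H} = 4"
    "card {p. p \<subseteq> V - {u} - {v} \<and> card p = 2 \<and> insert u p \<in> H} = 4"
  proof -
    have "{p. p \<subseteq> V - {u} - {v} \<and> card p = 2 \<and> insert v p \<in> H} =
        {p. p \<subseteq> V - {u} - {v} \<and> card p = 2 \<and> insert v p \<in> ?Hu}"
      using uv by auto
    then show "card {p. p \<subseteq> V - {u} - {v} \<and> card p = 2 \<and> insert v p \<in> H} = 4"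
      using card_link[OF T(1), of v] uv four by auto
    have "{p. p \<subseteq> V - {v} - {u} \<and> card p = 2 \<and> insert u p \<in> H} =
        {p. p \<subseteq> V - {v} - {u} \<and> card p = 2 \<and> insert u p \<in> ?Hv}"
      using uv by auto
    then show "card {p. p \<subseteq> V - {u} - {v} \<and> card p = 2 \<and> insert u p \<in> H} = 4"
      unfolding Vuv using card_link[OF T(2), of u] uv four by auto
  qed
  show False
    using TK cV FK eight
  proof (cases rule: six_points_cases)
    case (double a a' b b' c c')
    interpret H: double_K4_system H a a' b b' c c' using double(1) sub by (rule double_K4_system_mono)
    have "v \<notin> {a, a', b, b', c, c'}" using double(2) by blast
    from H.card_link_le[OF free this] show False using link(1) unfolding double(2) by simp
  next
    case (oct A B C)
    interpret H: octahedron H A B C using oct(1) sub by (rule octahedron_mono)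
    have notin: "u \<notin> A \<union> B \<union> C" "v \<notin> A \<union> B \<union> C" using oct(2) by blast+
    have X: "3 \<le> card {x \<in> A \<union> B \<union> C. {u, v, x} \<in> H}"
    proof -
      have "{e \<in> H. {u, v} \<subseteq> e} \<subseteq> (\<lambda>x. {u, v, x}) ` {x \<in> A \<union> B \<union> C. {u, v, x} \<in> H}"
      proof
        fix e assume e: "e \<in> {e \<in> H. {u, v} \<subseteq> e}"
        then have "card e = 3" "e \<subseteq> V" using H by (auto simp: triple_system_def)
        then obtain x where x: "e = {u, v, x}" "x \<notin> {u, v}" using triple_third[of e u v] e uv by blast
        then have "x \<in> A \<union> B \<union> C" using \<open>e \<subseteq> V\<close> oct(2) by blast
        then show "e \<in> (\<lambda>x. {u, v, x}) ` {x \<in> A \<union> B \<union> C. {u, v, x} \<in> H}" using x e by blast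
      qed
      then have "card {e \<in> H. {u, v} \<subseteq> e} \<le> card {x \<in> A \<union> B \<union> C. {u, v, x} \<in> H}"
        using H.fin by (intro surj_card_le) simp_all
      then show ?thesis using cod by simp
    qed
    have jv: "(\<forall>x \<in> A. \<forall>y \<in> B. {v, x, y} \<in> H) \<or> (\<forall>x \<in> B. \<forall>y \<in> C. {v, x, y} \<in> H) \<or>
        (\<forall>x \<in> C. \<forall>y \<in> A. {v, x, y} \<in> H)"
      by (rule H.joined[OF free notin(2)]) (use link(1) oct(2) in simp)
    have ju: "(\<forall>x \<in> A. \<forall>y \<in> B. {u, x, y} \<in> H) \<or> (\<forall>x \<in> B. \<forall>y \<in> C. {u, x, y} \<in> H) \<or>
        (\<forall>x \<in> C. \<forall>y \<in> A. {u, x, y} \<in> H)"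
      by (rule H.joined[OF free notin(1)]) (use link(2) oct(2) in simp)
    have U: "B \<union> C \<union> A = A \<union> B \<union> C" "C \<union> A \<union> B = A \<union> B \<union> C" by auto
    have "has_berge_K4 H"
      using ju
    proof (elim disjE)
      assume "\<forall>x \<in> A. \<forall>y \<in> B. {u, x, y} \<in> H"
      then show ?thesis using H.two_joined[OF uv(3) notin _ _ X] jv by blast
    next
      assume "\<forall>x \<in> B. \<forall>y \<in> C. {u, x, y} \<in> H"
      then show ?thesis
        using octahedron.two_joined[OF H.rotate uv(3), unfolded U, OF notin _ _ X] jv by blast
    next
      assume "\<forall>x \<in> C. \<forall>y \<in> A. {u, x, y} \<in> H"
      then show ?thesis
        using octahedron.two_joined[OF octahedron.rotate[OF H.rotate] uv(3), unfolded U, OF notin _ _ X] jv by blast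
    qed
    then show False using free by (simp add: B_free_def)
  qed
qed

lemma sum_nat_eq_boundD:
  fixes g :: "'a \<Rightarrow> nat"
  assumes "finite S" "\<And>x. x \<in> S \<Longrightarrow> g x \<le> k" "k * card S \<le> sum g S" "x \<in> S"
  shows "g x = k"
proof (rule ccontr)
  assume "g x \<noteq> k"
  then have "g x < k" using assms(2,4) by (simp add: order_le_neq_trans)
  then have "sum g S < (\<Sum>x \<in> S. k)" using assms by (intro sum_strict_mono_ex1) auto
  then show False using assms(3) by (simp add: mult.commute)
qed

lemma eight_bound:
  assumes H: "triple_system V H" and V: "card V = 8" and free: "B_free H"
  shows "card H \<le> 18"
proof (rule ccontr)
  assume "\<not> ?thesis"
  then have "19 \<le> card H" by simp
  then obtain H' where H': "H' \<subseteq> H" "card H' = 19" by (meson obtain_subset_with_card_n)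
  have fin: "finite V" using V by (intro card_ge_0_finite) simp
  have T: "triple_system V H'" using H H'(1) by (rule triple_system_subset)
  have F: "B_free H'" using free H'(1) by (rule B_free_subset)
  have finH: "finite H'" using triple_system_finite[OF T fin] .
  define deg where "deg v = card {e \<in> H'. v \<in> e}" for v
  define cod where "cod u v = card {e \<in> H'. {u, v} \<subseteq> e}" for u v
  have cod_sym: "cod u v = cod v u" for u v by (simp add: cod_def insert_commute)
  \<comment> \<open>Seven points carry at most 12 of the 19 triples.\<close>
  have deg7: "7 \<le> deg v" if "v \<in> V" for v
  proof -
    have "card {e \<in> H'. v \<notin> e} \<le> 12"
    proof (rule seven_bound)
      show "triple_system (V - {v}) {e \<in> H'. v \<notin> e}" using T by (rule triple_system_delete)
      show "card (V - {v}) = 7" using V that fin by simp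
      show "B_free {e \<in> H'. v \<notin> e}" using F by (rule B_free_subset) auto
    qed
    then show ?thesis using card_split_vertex[OF finH, of v] H'(2) by (simp add: deg_def)
  qed
  have sumdeg: "(\<Sum>v \<in> V. deg v) = 57" using sum_degrees[OF T fin] H'(2) by (simp add: deg_def)
  obtain w where w: "w \<in> V" "8 \<le> deg w"
  proof (rule ccontr)
    assume "\<not> thesis"
    then have "deg v \<le> 7" if "v \<in> V" for v using that \<open>\<And>w. w \<in> V \<Longrightarrow> 8 \<le> deg w \<Longrightarrow> thesis\<close> by force
    then have "(\<Sum>v \<in> V. deg v) \<le> (\<Sum>v \<in> V. 7)" by (intro sum_mono)
    then show False using sumdeg V by simp
  qed
  have cVw: "card (V - {w}) = 7" using V w fin by simp
  have split: "deg w + (\<Sum>v \<in> V - {w}. deg v) = 57" using sumdeg w fin by (simp add: sum.remove)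
  have "(\<Sum>v \<in> V - {w}. 7) \<le> (\<Sum>v \<in> V - {w}. deg v)" using deg7 by (intro sum_mono) auto
  \<comment> \<open>Since 57 = 8 + 7 * 7, no degree exceeds its minimum except that of
    \<open>w\<close>, and that by one only.\<close>
  then have degw: "deg w = 8" using split w cVw by simp
  have deg_eq: "deg v = 7" if "v \<in> V - {w}" for v
  proof -
    have "deg v + (\<Sum>v \<in> V - {w} - {v}. deg v) = 49"
      using split degw that fin by (simp add: sum.remove)
    moreover have "(\<Sum>v \<in> V - {w} - {v}. 7) \<le> (\<Sum>v \<in> V - {w} - {v}. deg v)"
      using deg7 by (intro sum_mono) auto
    moreover have "card (V - {w} - {v}) = 6" using cVw that fin by simp
    ultimately show ?thesis using deg7[of v] that by simp
  qed
  have cod2: "cod u v \<le> 2" if "u \<in> V - {w}" "v \<in> V - {w}" "u \<noteq> v" for u v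
    using eight_point_pair[OF T V F H'(2), of u v] that deg_eq[of u] deg_eq[of v]
    by (simp add: deg_def cod_def)
  have sumcod: "(\<Sum>u \<in> V - {v}. cod u v) = 2 * deg v" for v
    using sum_codegrees[OF T fin] by (simp add: deg_def cod_def)
  have sum14: "cod w v + (\<Sum>u \<in> V - {v} - {w}. cod u v) = 14" and c6: "card (V - {v} - {w}) = 6"
    if "v \<in> V - {w}" for v
  proof -
    have "w \<in> V - {v}" using that w by auto
    then show "cod w v + (\<Sum>u \<in> V - {v} - {w}. cod u v) = 14"
      using sumcod[of v] deg_eq[OF that] sum.remove[of "V - {v}" w "\<lambda>u. cod u v"] fin by simp
    show "card (V - {v} - {w}) = 6" using \<open>w \<in> V - {v}\<close> that V fin by simp
  qed
  \<comment> \<open>The codegrees at \<open>v\<close> sum to 14, and the six vertices other than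
    \<open>v\<close> and \<open>w\<close> contribute at most 12.\<close>
  have codw: "2 \<le> cod w v" if "v \<in> V - {w}" for v
  proof -
    have "(\<Sum>u \<in> V - {v} - {w}. cod u v) \<le> (\<Sum>u \<in> V - {v} - {w}. 2)"
      using cod2 that by (intro sum_mono) auto
    then show ?thesis using sum14[OF that] c6[OF that] by simp
  qed
  define X where "X = {v \<in> V - {w}. cod w v = 2}"
  have finX: "finite X" using fin by (simp add: X_def)
  \<comment> \<open>The seven codegrees at \<open>w\<close> are at least two and sum to 16 = 7 * 2 +
    2, so at most two of them exceed two.\<close>
  have cX: "5 \<le> card X"
  proof -
    let ?Y = "V - {w} - X"
    have XV: "X \<subseteq> V - {w}" by (auto simp: X_def)
    have "(\<Sum>v \<in> X. 2) + (\<Sum>v \<in> ?Y. 3) \<le> (\<Sum>v \<in> X. cod w v) + (\<Sum>v \<in> ?Y. cod w v)"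
    proof (intro add_mono sum_mono)
      fix v assume v: "v \<in> ?Y"
      then have "cod w v \<noteq> 2" "2 \<le> cod w v" using codw[of v] by (auto simp: X_def)
      then show "3 \<le> cod w v" by simp
    qed (simp add: X_def)
    also have "\<dots> = (\<Sum>v \<in> V - {w}. cod w v)"
      using sum.subset_diff[OF XV, of "cod w"] fin by simp
    also have "\<dots> = 16" using sumcod[of w] degw by (simp add: cod_sym)
    finally have "2 * card X + 3 * card ?Y \<le> 16" by simp
    moreover have "card ?Y = 7 - card X" using cVw XV finX by (simp add: card_Diff_subset)
    ultimately show ?thesis using cVw by simp
  qed
  \<comment> \<open>With \<open>w\<close> contributing exactly two, the other six codegrees at
    \<open>v\<close> must sum to 12, so each attains its upper bound.\<close>
  have all2: "cod u v = 2" if "u \<in> X" "v \<in> X" "u \<noteq> v" for u v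
  proof -
    have v: "v \<in> V - {w}" "cod w v = 2" using that by (auto simp: X_def)
    show ?thesis
    proof (rule sum_nat_eq_boundD[of "V - {v} - {w}" "\<lambda>u. cod u v"])
      show "2 * card (V - {v} - {w}) \<le> (\<Sum>u \<in> V - {v} - {w}. cod u v)"
        using sum14[OF v(1)] c6[OF v(1)] v(2) by simp
    qed (use that v fin cod2 in \<open>auto simp: X_def\<close>)
  qed
  \<comment> \<open>A fourth point \<open>a\<close> of \<open>X\<close> serves as the apex opposite
    to a hypothetical missing triple; hence \<open>X\<close> must carry all its triples.\<close>
  have inH: "{b, c, d} \<in> H'" if "distinct [a, b, c, d]" "{a, b, c, d} \<subseteq> X" for a b c d
  proof (rule ccontr)
    assume "{b, c, d} \<notin> H'"
    moreover have "2 \<le> card {e \<in> H'. {x, y} \<subseteq> e}" if "x \<in> {a, b, c, d}" "y \<in> {a, b, c, d}" "x \<noteq> y" for x y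
      using all2[of x y] that \<open>{a, b, c, d} \<subseteq> X\<close> unfolding cod_def by (metis order_refl subsetD)
    ultimately have "has_berge_K4 H'" using has_berge_K4_if_codegrees[OF T that(1)] by blast
    then show False using F by (simp add: B_free_def)
  qed
  obtain a b c d e where abcde: "distinct [a, b, c, d, e]" "{a, b, c, d, e} \<subseteq> X"
  proof -
    obtain Y where Y: "Y \<subseteq> X" "card Y = 5" using cX by (meson obtain_subset_with_card_n)
    then obtain xs where xs: "set xs = Y" "distinct xs" using finX by (meson finite_distinct_list finite_subset)
    then have "length xs = 5" using Y distinct_card by metis
    then obtain a b c d e where "xs = [a, b, c, d, e]" by (auto simp: numeral_eq_Suc length_Suc_conv)
    then show thesis using xs Y by (intro that[of a b c d e]) auto
  qed
  \<comment> \<open>Five points give three triples through \<open>a, b\<close>, against codegree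
    two.\<close>
  have sub3: "{{a, b, c}, {a, b, d}, {a, b, e}} \<subseteq> {e \<in> H'. {a, b} \<subseteq> e}"
    using inH[of e a b c] inH[of e a b d] inH[of c a b e] abcde by auto
  have card3: "card {{a, b, c}, {a, b, d}, {a, b, e}} = 3"
  proof -
    have "c \<notin> {a, b, d}" "c \<notin> {a, b, e}" "d \<notin> {a, b, e}" using abcde by auto
    then have "{a, b, c} \<noteq> {a, b, d}" "{a, b, c} \<noteq> {a, b, e}" "{a, b, d} \<noteq> {a, b, e}"
      by (metis insertI1 insertI2)+
    then show ?thesis by simp
  qed
  have "finite {e \<in> H'. {a, b} \<subseteq> e}" using finH by simp
  from card_mono[OF this sub3] have "3 \<le> cod a b" unfolding cod_def card3 .
  then show False using all2[of a b] abcde by auto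
qed

subsection \<open>Arithmetic of the extremal function\<close>

lemma f_mod_3: "f (3 * k) = k * k * k" "f (3 * k + 1) = k * k * (k + 1)" "f (3 * k + 2) = k * (k + 1) * (k + 1)"
proof -
  have "3 * k div 3 = k" "(3 * k + 1) div 3 = k" "(3 * k + 2) div 3 = k" "(3 * k + 1 + 1) div 3 = k"
    "(3 * k + 1 + 2) div 3 = k + 1" "(3 * k + 2 + 1) div 3 = k + 1" "(3 * k + 2 + 2) div 3 = k + 1"
    by presburger+
  then show "f (3 * k) = k * k * k" "f (3 * k + 1) = k * k * (k + 1)" "f (3 * k + 2) = k * (k + 1) * (k + 1)"
    unfolding f_def by simp_all
qed

lemma mod_3_cases:
  obtains k :: nat where "n = 3 * k" | k where "n = 3 * k + 1" | k where "n = 3 * k + 2"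
proof -
  have "n = 3 * (n div 3) \<or> n = 3 * (n div 3) + 1 \<or> n = 3 * (n div 3) + 2" by presburger
  then show thesis using that by blast
qed

lemma square_div_3:
  "(3 * k) * (3 * k) div 3 = 3 * k * k"
  "(3 * k + 1) * (3 * k + 1) div 3 = 3 * k * k + 2 * k"
  "(3 * k + 2) * (3 * k + 2) div 3 = 3 * k * k + 4 * k + (1 :: nat)"
proof -
  have "(3 * k + 1) * (3 * k + 1) = 1 + 3 * (3 * k * k + 2 * k)"
    "(3 * k + 2) * (3 * k + 2) = 1 + 3 * (3 * k * k + 4 * k + 1)"
    by (simp_all add: algebra_simps)
  then show "(3 * k + 1) * (3 * k + 1) div 3 = 3 * k * k + 2 * k"
    "(3 * k + 2) * (3 * k + 2) div 3 = 3 * k * k + 4 * k + 1" by presburger+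
qed simp

text \<open>One point is added to each part of a balanced partition a, b, c of m: the product grows
  by (ab + bc + ca) + (a + b + c) + 1, and the first sum is [m^2/3].\<close>

lemma f_add_3: "f (m + 3) = f m + m * m div 3 + m + 1"
proof (cases m rule: mod_3_cases)
  case (1 k)
  have "m + 3 = 3 * (k + 1)" using 1 by simp
  then show ?thesis unfolding 1 by (simp only: f_mod_3 square_div_3) (simp add: algebra_simps)
next
  case (2 k)
  have "m + 3 = 3 * (k + 1) + 1" using 2 by simp
  then show ?thesis unfolding 2 by (simp only: f_mod_3 square_div_3) (simp add: algebra_simps)
next
  case (3 k)
  have "m + 3 = 3 * (k + 1) + 2" using 3 by simp
  then show ?thesis unfolding 3 by (simp only: f_mod_3 square_div_3) (simp add: algebra_simps)
qed

lemma pairwise_products_le: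
  fixes x y z :: nat
  shows "x * y + y * z + z * x \<le> (x + y + z) * (x + y + z) div 3"
proof -
  have "2 * (x * y) \<le> x * x + y * y" for x y :: nat
  proof -
    have "0 \<le> (int x - int y) * (int x - int y)" by simp
    then have "int (2 * (x * y)) \<le> int (x * x + y * y)" by (simp add: algebra_simps)
    then show ?thesis by linarith
  qed
  from this[of x y] this[of y z] this[of z x]
  have "3 * (x * y + y * z + z * x) \<le> (x + y + z) * (x + y + z)"
    by (simp add: algebra_simps)
  then show ?thesis by (simp add: less_eq_div_iff_mult_less_eq mult.commute)
qed

text \<open>All three factors are lowered by one together, in step with \<open>f_add_3\<close>, so
  the induction needs no balancing argument; the mixed terms are controlled by
  \<open>pairwise_products_le\<close>.\<close>

lemma prod_le_f: "x * y * z \<le> f (x + y + z)"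
proof (induction x arbitrary: y z)
  case (Suc a)
  show ?case
  proof (cases "y = 0 \<or> z = 0")
    case False
    then obtain b c where yz: "y = Suc b" "z = Suc c" by (metis not0_implies_Suc)
    have "Suc a * y * z = a * b * c + (a * b + b * c + c * a) + (a + b + c) + 1"
      unfolding yz by (simp add: algebra_simps)
    also have "\<dots> \<le> f (a + b + c) + (a + b + c) * (a + b + c) div 3 + (a + b + c) + 1"
      using Suc.IH[of b c] pairwise_products_le[of a b c] by linarith
    also have "\<dots> = f (a + b + c + 3)" by (rule f_add_3[symmetric])
    also have "a + b + c + 3 = Suc a + y + z" using yz by simp
    finally show ?thesis .
  qed auto
qed simp

text \<open>At n = 9 both sides are 27; at n = 8 the left side is 21 and the right side 18.\<close>

lemma square_div_3_le_f:
  assumes "9 \<le> n" shows "n * n div 3 \<le> f n"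
proof (cases n rule: mod_3_cases)
  case (1 k)
  then have "3 * k * k \<le> k * k * k" using assms by simp
  then show ?thesis unfolding 1 f_mod_3 square_div_3 .
next
  case (2 k)
  then have "3 \<le> k" using assms by simp
  then obtain j where "k = j + 3" by (metis add.commute le_Suc_ex)
  then have "3 * k * k + 2 * k \<le> k * k * (k + 1)" by (simp add: algebra_simps)
  then show ?thesis unfolding 2 f_mod_3 square_div_3 .
next
  case (3 k)
  have "3 \<le> k" using assms 3 by simp
  then obtain j where "k = j + 3" by (metis add.commute le_Suc_ex)
  then have "3 * k * k + 4 * k + 1 \<le> k * (k + 1) * (k + 1)" by (simp add: algebra_simps)
  then show ?thesis unfolding 3 f_mod_3 square_div_3 .
qed

lemma square_div_4: "m * m div 4 = (m div 2) * (m - m div 2)" for m :: nat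
proof (cases "even m")
  case True
  then obtain k where "m = 2 * k" by blast
  then show ?thesis by simp
next
  case False
  then obtain k where m: "m = 2 * k + 1" by (elim oddE)
  have "m * m = 1 + 4 * (k * (k + 1))" unfolding m by (simp add: algebra_simps)
  then have "m * m div 4 = k * (k + 1)" by presburger
  then show ?thesis unfolding m by simp
qed

text \<open>That is, \<open>\<lfloor>m\<^sup>2/4\<rfloor> / m\<close> increases with \<open>m\<close>.\<close>

lemma square_div_4_quotient_mono:
  fixes p s :: nat
  assumes "p \<le> s" shows "s * (p * p div 4) \<le> p * (s * s div 4)"
proof -
  define i j where "i = p div 2" and "j = s div 2"
  have eq: "p * p div 4 = i * (p - i)" "s * s div 4 = j * (s - j)"
    by (simp_all add: square_div_4 i_def j_def)
  have "i \<le> j" using assms by (simp add: i_def j_def div_le_mono)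
  consider "p = 2 * i" "s = 2 * j" | "p = 2 * i + 1" "s = 2 * j + 1" | "p = 2 * i" "s = 2 * j + 1"
    | "p = 2 * i + 1" "s = 2 * j" "i + 1 \<le> j"
    using assms unfolding i_def j_def by linarith
  then have "s * (i * (p - i)) \<le> p * (j * (s - j))"
  proof cases
    case 1
    then show ?thesis using \<open>i \<le> j\<close> by simp
  next
    case 2
    obtain d where "j = i + d" using \<open>i \<le> j\<close> le_Suc_ex by blast
    then show ?thesis using 2 by (simp add: algebra_simps)
  next
    case 3
    obtain d where "j = i + d" using \<open>i \<le> j\<close> le_Suc_ex by blast
    then show ?thesis using 3 by (simp add: algebra_simps)
  next
    case 4
    obtain d where "j = i + 1 + d" using 4(3) le_Suc_ex by blast
    then show ?thesis using 4(1,2) by (simp add: algebra_simps)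
  qed
  then show ?thesis unfolding eq .
qed

text \<open>Convexity in division-free form: s = p + q times the bound is at most p times its value
  for q = 0 plus q times its value for p = 0. With s split into halves y and z, these values are the
  product cyz, bounded by \<open>prod_le_f\<close>, and the sum yz + zc + cy, bounded by
  \<open>pairwise_products_le\<close>.\<close>

lemma red_blue_bound_le_f:
  assumes "9 \<le> p + q + c" "1 \<le> c"
  shows "(c - 1) * (p * p div 4) + (p + q) * (p + q) div 4 + c * q \<le> f (p + q + c)"
proof (cases "p + q = 0")
  case False
  define s where "s = p + q"
  define y z where "y = s div 2" and "z = s - s div 2"
  have yz: "y + z = s" "s * s div 4 = y * z" by (auto simp: y_def z_def square_div_4)
  obtain d where c: "c = d + 1" using assms(2) by (metis add.commute le_Suc_ex)
  let ?F = "s * s div 4"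
  have F1: "c * ?F \<le> f (s + c)"
    using prod_le_f[of c y z] yz by (simp add: ac_simps)
  have "?F + c * s = y * z + z * c + c * y" by (simp only: yz(2)) (simp add: yz(1)[symmetric] algebra_simps)
  also have "\<dots> \<le> (s + c) * (s + c) div 3"
    using pairwise_products_le[of y z c] yz(1) by simp
  also have "\<dots> \<le> f (s + c)"
    using assms(1) by (intro square_div_3_le_f) (simp add: s_def)
  finally have F2: "?F + c * s \<le> f (s + c)" .
  have "s * ((c - 1) * (p * p div 4) + ?F + c * q) = d * (s * (p * p div 4)) + s * ?F + c * s * q"
    unfolding c by (simp add: algebra_simps)
  also have "\<dots> \<le> d * (p * ?F) + s * ?F + c * s * q"
    using square_div_4_quotient_mono[of p s] by (simp add: s_def)
  also have "\<dots> = p * (c * ?F) + q * (?F + c * s)"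
    unfolding c s_def by (simp add: algebra_simps)
  also have "\<dots> \<le> p * f (s + c) + q * f (s + c)"
    using F1 F2 by (intro add_mono mult_le_mono2)
  also have "\<dots> = s * f (s + c)" by (simp add: s_def algebra_simps)
  finally show ?thesis using False by (auto simp: s_def)
qed auto

subsection \<open>The theorems of Hall and Mantel\<close>

text \<open>If some nonempty proper subset is tight, it is matched on its own and the rest is
  matched outside its neighbourhood. Otherwise every such subset has a spare neighbour, so one
  element may be matched arbitrarily.\<close>

theorem hall_marriage:
  assumes "finite I" "\<And>i. i \<in> I \<Longrightarrow> finite (N i)"
    and "\<And>J. J \<subseteq> I \<Longrightarrow> card J \<le> card (\<Union> (N ` J))"
  shows "\<exists>r. inj_on r I \<and> (\<forall>i \<in> I. r i \<in> N i)"
  using assms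
proof (induction "card I" arbitrary: I N rule: less_induct)
  case less
  note fin = less.prems(1) and finN = less.prems(2) and hall = less.prems(3)
  show ?case
  proof (cases "\<exists>J. J \<subseteq> I \<and> J \<noteq> {} \<and> J \<noteq> I \<and> card (\<Union> (N ` J)) = card J")
    case True
    then obtain J where J: "J \<subseteq> I" "J \<noteq> {}" "J \<noteq> I" "card (\<Union> (N ` J)) = card J" by blast
    have finJ: "finite J" using J fin finite_subset by blast
    let ?U = "\<Union> (N ` J)"
    have "card J < card I" using J fin by (intro psubset_card_mono) auto
    then obtain r1 where r1: "inj_on r1 J" "\<forall>i \<in> J. r1 i \<in> N i"
      using less.hyps[of J N] finJ J(1) finN hall by (metis (no_types, lifting) order_trans subsetD)
    have lt: "card (I - J) < card I" using J fin by (intro psubset_card_mono) auto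
    have "card K \<le> card (\<Union> ((\<lambda>i. N i - ?U) ` K))" if K: "K \<subseteq> I - J" for K
    proof -
      have finK: "finite K" using K fin finite_subset by blast
      have "card K + card J = card (K \<union> J)" using K finK finJ by (subst card_Un_disjoint) auto
      also have "\<dots> \<le> card (\<Union> (N ` (K \<union> J)))" using K J by (intro hall) auto
      also have "\<Union> (N ` (K \<union> J)) = \<Union> ((\<lambda>i. N i - ?U) ` K) \<union> ?U" by auto
      also have "card \<dots> \<le> card (\<Union> ((\<lambda>i. N i - ?U) ` K)) + card ?U" by (rule card_Un_le)
      finally show ?thesis using J(4) by simp
    qed
    then obtain r2 where r2: "inj_on r2 (I - J)" "\<forall>i \<in> I - J. r2 i \<in> N i - ?U"
      using less.hyps[OF lt, of "\<lambda>i. N i - ?U"] fin finN by auto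
    define r where "r i = (if i \<in> J then r1 i else r2 i)" for i
    have cross: "r1 i \<noteq> r2 j" if "i \<in> J" "j \<in> I - J" for i j
    proof
      assume "r1 i = r2 j"
      moreover have "r1 i \<in> ?U" "r2 j \<notin> ?U" using r1 r2 that by auto
      ultimately show False by simp
    qed
    have "inj_on r I"
    proof (rule inj_onI)
      fix i j assume ij: "i \<in> I" "j \<in> I" "r i = r j"
      then show "i = j"
        using cross[of i j] cross[of j i] inj_onD[OF r1(1), of i j] inj_onD[OF r2(1), of i j]
        by (auto simp: r_def split: if_splits)
    qed
    moreover have "\<forall>i \<in> I. r i \<in> N i" using r1 r2 by (auto simp: r_def)
    ultimately show ?thesis by blast
  next
    case False
    show ?thesis
    proof (cases "I = {}")
      case nonempty: False
      then obtain i where i: "i \<in> I" by blast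
      have "1 \<le> card (N i)" using hall[of "{i}"] i by simp
      then obtain x where x: "x \<in> N i" by fastforce
      have lt: "card (I - {i}) < card I" using i fin by (intro psubset_card_mono) auto
      have "card K \<le> card (\<Union> ((\<lambda>j. N j - {x}) ` K))" if K: "K \<subseteq> I - {i}" for K
      proof (cases "K = {}")
        case False
        have KI: "K \<subseteq> I" "K \<noteq> I" using K i by auto
        then have "card (\<Union> (N ` K)) \<noteq> card K" using False \<open>\<not> (\<exists>J. _ J)\<close> by blast
        then have "card K < card (\<Union> (N ` K))" using hall[OF KI(1)] by simp
        moreover have "\<Union> ((\<lambda>j. N j - {x}) ` K) = \<Union> (N ` K) - {x}" by auto
        moreover have "card (\<Union> (N ` K)) \<le> Suc (card (\<Union> (N ` K) - {x}))"
          by (simp add: card_Diff_singleton_if) arith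
        ultimately show ?thesis by simp
      qed simp
      then obtain r where r: "inj_on r (I - {i})" "\<forall>j \<in> I - {i}. r j \<in> N j - {x}"
        using less.hyps[OF lt, of "\<lambda>j. N j - {x}"] fin finN by auto
      have "inj_on (r(i := x)) I"
      proof (rule inj_onI)
        fix j k assume "j \<in> I" "k \<in> I" "(r(i := x)) j = (r(i := x)) k"
        then show "j = k"
          using r by (cases "j = i"; cases "k = i") (auto dest: inj_onD)
      qed
      moreover have "\<forall>j \<in> I. (r(i := x)) j \<in> N j" using r x by auto
      ultimately show ?thesis by blast
    qed simp
  qed
qed

lemma ex_maximizer:
  fixes d :: "'a \<Rightarrow> 'b :: linorder"
  assumes "finite W" "W \<noteq> {}"
  shows "\<exists>u \<in> W. \<forall>v \<in> W. d v \<le> d u"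
proof -
  have "Max (d ` W) \<in> d ` W" using assms by (intro Max_in) auto
  then obtain u where u: "u \<in> W" "d u = Max (d ` W)" by auto
  then have "d v \<le> d u" if "v \<in> W" for v using that assms(1) by simp
  then show ?thesis using u(1) by blast
qed

lemma card_le_sum_incidence:
  assumes "finite C" "finite X" "\<And>e. e \<in> X \<Longrightarrow> e \<inter> C \<noteq> {}"
  shows "card X \<le> (\<Sum>v \<in> C. card {e \<in> X. v \<in> e})"
proof -
  have "X = (\<Union>v \<in> C. {e \<in> X. v \<in> e})" using assms(3) by blast
  then show ?thesis using card_UN_le[OF assms(1), of "\<lambda>v. {e \<in> X. v \<in> e}"] by simp
qed

lemma mult_le_square_div_4: "a * b \<le> (a + b) * (a + b) div 4" for a b :: nat
proof -
  have "0 \<le> (int a - int b) * (int a - int b)" by simp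
  then have "int (4 * (a * b)) \<le> int ((a + b) * (a + b))" by (simp add: algebra_simps)
  then have "4 * (a * b) \<le> (a + b) * (a + b)" by linarith
  then show ?thesis by (simp add: less_eq_div_iff_mult_less_eq mult.commute)
qed

lemma pair_through:
  assumes "card p = 2" "u \<in> p" obtains x where "p = {u, x}" "x \<noteq> u"
  using assms by (auto simp: card_2_iff)

text \<open>The neighbourhood \<open>N\<close> of a vertex of maximum degree spans no edge, so every
  edge meets its complement, where each vertex has degree at most |N|.\<close>

lemma mantel:
  assumes W: "finite W" and E: "\<And>p. p \<in> E \<Longrightarrow> p \<subseteq> W \<and> card p = 2"
    and free: "\<And>x y z. {x, y} \<in> E \<Longrightarrow> {y, z} \<in> E \<Longrightarrow> {x, z} \<in> E \<Longrightarrow> False"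
  shows "card E \<le> card W * card W div 4"
proof (cases "W = {}")
  case True
  then have "E = {}" using E by force
  then show ?thesis by simp
next
  case False
  have finE: "finite E" using E W by (meson finite_Pow_iff finite_subset Pow_iff subsetI)
  define d where "d v = card {p \<in> E. v \<in> p}" for v
  obtain u where u: "u \<in> W" "\<And>v. v \<in> W \<Longrightarrow> d v \<le> d u"
    using ex_maximizer[OF W False, of d] by blast
  define N where "N = {x \<in> W. {u, x} \<in> E}"
  have N: "N \<subseteq> W" "finite N" using W by (auto simp: N_def)
  have du: "d u \<le> card N"
  proof -
    have "{p \<in> E. u \<in> p} \<subseteq> (\<lambda>x. {u, x}) ` N"
    proof
      fix p assume p: "p \<in> {p \<in> E. u \<in> p}"
      then have c: "card p = 2" "u \<in> p" using E by auto
      then obtain x where x: "p = {u, x}" by (rule pair_through)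
      then have "x \<in> N" using p E[of p] by (auto simp: N_def)
      then show "p \<in> (\<lambda>x. {u, x}) ` N" using x by blast
    qed
    then show ?thesis unfolding d_def using N(2) by (intro surj_card_le)
  qed
  have "card E \<le> (\<Sum>v \<in> W - N. d v)"
    unfolding d_def
  proof (rule card_le_sum_incidence)
    fix p assume p: "p \<in> E"
    then obtain x y where xy: "p = {x, y}" using E by (metis card_2_iff)
    show "p \<inter> (W - N) \<noteq> {}"
    proof
      assume "p \<inter> (W - N) = {}"
      then have "x \<in> N" "y \<in> N" using xy E[OF p] by auto
      then show False using free[of u x y] p xy by (auto simp: N_def)
    qed
  qed (use W finE in auto)
  also have "\<dots> \<le> (\<Sum>v \<in> W - N. card N)" using u(2) du by (intro sum_mono) (meson DiffD1 le_trans)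
  also have "\<dots> = card (W - N) * card N" by simp
  also have "\<dots> \<le> (card (W - N) + card N) * (card (W - N) + card N) div 4" by (rule mult_le_square_div_4)
  also have "card (W - N) + card N = card W" using N W by (simp add: card_Diff_subset card_mono)
  finally show ?thesis .
qed

subsection \<open>The red and blue graph\<close>

text \<open>For edge sets made of two-element sets, a repeated point would put a singleton into
  \<open>G\<close>, so the formula speaks of genuine K_4 subgraphs.\<close>

definition K4_free :: "'a set set \<Rightarrow> bool" where
  "K4_free G \<longleftrightarrow> (\<forall>a b c d. \<not> {{a, b}, {a, c}, {a, d}, {b, c}, {b, d}, {c, d}} \<subseteq> G)"

lemma red_blue_decomposition:
  assumes H: "triple_system V H" and V: "finite V" and free: "B_free H"
  obtains R B where "\<And>p. p \<in> R \<union> B \<Longrightarrow> p \<subseteq> V \<and> card p = 2" "R \<inter> B = {}" "K4_free (R \<union> B)"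
    "card H \<le> card {T. T \<subseteq> V \<and> card T = 3 \<and> (\<forall>p. p \<subseteq> T \<and> card p = 2 \<longrightarrow> p \<in> R)} + card B"
proof -
  have finH: "finite H" using triple_system_finite[OF H V] .
  define P where "P e = {p. p \<subseteq> e \<and> card p = 2}" for e :: "'a set"
  have PV: "p \<subseteq> V \<and> card p = 2" if "p \<in> P e" "e \<in> H" for p e
    using that H by (auto simp: P_def triple_system_def)
  have finP: "finite (P e)" if "e \<in> H" for e
    using PV[OF _ that] V by (meson finite_Pow_iff finite_subset Pow_iff subsetI)
  have finU: "finite (\<Union> (P ` S))" if "S \<subseteq> H" for S
    using that finP finite_subset[OF that finH] by auto
  define deficiency where "deficiency S = int (card S) - int (card (\<Union> (P ` S)))" for S
  obtain S where S: "S \<subseteq> H" and max: "\<And>T. T \<subseteq> H \<Longrightarrow> deficiency T \<le> deficiency S"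
    using ex_maximizer[OF _ Pow_not_empty, of H "deficiency"] finH by auto
  have finS: "finite S" using S finH finite_subset by blast
  define R where "R = \<Union> (P ` S)"
  have finR: "finite R" using finU[OF S] by (simp add: R_def)
  have "\<exists>r. inj_on r R \<and> (\<forall>p \<in> R. r p \<in> {e \<in> S. p \<in> P e})"
  proof (rule hall_marriage[OF finR])
    fix T assume T: "T \<subseteq> R"
    let ?N = "\<Union> ((\<lambda>p. {e \<in> S. p \<in> P e}) ` T)"
    have NS: "?N \<subseteq> S" by auto
    \<comment> \<open>Once the triples meeting \<open>T\<close> are removed from \<open>S\<close>,
      no pair of \<open>T\<close> is covered any more.\<close>
    have "\<Union> (P ` (S - ?N)) \<subseteq> R - T" by (auto simp: R_def)
    then have "card (\<Union> (P ` (S - ?N))) \<le> card (R - T)" using finR by (intro card_mono) auto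
    also have "\<dots> = card R - card T" using T finR by (meson card_Diff_subset finite_subset)
    finally have 1: "card (\<Union> (P ` (S - ?N))) \<le> card R - card T" .
    have 2: "card (S - ?N) = card S - card ?N" "card ?N \<le> card S"
      using NS finS by (auto simp: card_Diff_subset finite_subset card_mono)
    have 3: "card T \<le> card R" using T finR by (rule card_mono[rotated])
    have "deficiency (S - ?N) \<le> deficiency S" using S by (intro max) auto
    then show "card T \<le> card ?N" using 1 2 3 unfolding deficiency_def R_def[symmetric] by linarith
  qed (use finS in auto)
  then obtain r where r: "inj_on r R" "\<And>p. p \<in> R \<Longrightarrow> r p \<in> S \<and> p \<in> P (r p)" by auto
  have "\<exists>t. inj_on t (H - S) \<and> (\<forall>e \<in> H - S. t e \<in> P e - R)"
  proof (rule hall_marriage)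
    fix T assume T: "T \<subseteq> H - S"
    let ?N = "\<Union> ((\<lambda>e. P e - R) ` T)"
    have finT: "finite T" using T finH finite_subset by blast
    \<comment> \<open>Adding \<open>T\<close> to \<open>S\<close> costs only the pairs in
      \<open>?N\<close>, so maximality bounds |T| by their number.\<close>
    have "\<Union> (P ` (S \<union> T)) = R \<union> ?N" by (auto simp: R_def)
    then have 1: "card (\<Union> (P ` (S \<union> T))) \<le> card R + card ?N" by (metis card_Un_le)
    have 2: "card (S \<union> T) = card S + card T" using T finS finT by (intro card_Un_disjoint) auto
    have "deficiency (S \<union> T) \<le> deficiency S" using S T by (intro max) auto
    then show "card T \<le> card ?N" using 1 2 unfolding deficiency_def R_def[symmetric] by linarith
  qed (use finH finP in auto)
  then obtain t where t: "inj_on t (H - S)" "\<And>e. e \<in> H - S \<Longrightarrow> t e \<in> P e \<and> t e \<notin> R" by auto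
  define B where "B = t ` (H - S)"
  have RB: "R \<inter> B = {}" using t by (auto simp: B_def)
  have pairs: "p \<subseteq> V \<and> card p = 2" if p: "p \<in> R \<union> B" for p
  proof -
    have "\<exists>e \<in> H. p \<in> P e" using p S t(2) by (auto simp: R_def B_def)
    then show ?thesis using PV by blast
  qed
  \<comment> \<open>Red pairs are sent into \<open>S\<close> and blue pairs back to the triples
    outside \<open>S\<close> that chose them, so the two injections have disjoint images.\<close>
  define g where "g p = (if p \<in> R then r p else the_inv_into (H - S) t p)" for p
  have gB: "g p \<in> H - S \<and> t (g p) = p" if "p \<in> B" for p
    using that RB the_inv_into_into[OF t(1), of p "H - S"] f_the_inv_into_f[OF t(1), of p]
    unfolding g_def B_def by auto
  have gR: "g p = r p" if "p \<in> R" for p using that by (simp add: g_def)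
  have g_inj: "inj_on g (R \<union> B)"
  proof (rule inj_onI)
    fix p q assume pq: "p \<in> R \<union> B" "q \<in> R \<union> B" "g p = g q"
    then show "p = q"
      using gB[of p] gB[of q] gR[of p] gR[of q] r(2)[of p] r(2)[of q] inj_onD[OF r(1), of p q] by auto
  qed
  have g: "g p \<in> H \<and> p \<subseteq> g p" if "p \<in> R \<union> B" for p
    using that gB[of p] gR[of p] r(2)[of p] S t(2)[of "g p"] by (auto simp: P_def)
  have "K4_free (R \<union> B)"
    unfolding K4_free_def
  proof (intro allI notI)
    fix a b c d assume K: "{{a, b}, {a, c}, {a, d}, {b, c}, {b, d}, {c, d}} \<subseteq> R \<union> B"
    then have "card {a, b} = 2" "card {a, c} = 2" "card {a, d} = 2" "card {b, c} = 2" "card {b, d} = 2" "card {c, d} = 2"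
      using pairs by auto
    then have dist: "distinct [a, b, c, d]" by auto
    have "distinct (map g [{a, b}, {a, c}, {a, d}, {b, c}, {b, d}, {c, d}])"
      unfolding distinct_map
    proof
      show "distinct [{a, b}, {a, c}, {a, d}, {b, c}, {b, d}, {c, d}]" using dist by (auto simp: doubleton_eq_iff)
      show "inj_on g (set [{a, b}, {a, c}, {a, d}, {b, c}, {b, d}, {c, d}])"
        using g_inj by (rule inj_on_subset) (use K in simp)
    qed
    then have dist': "distinct [g {a, b}, g {a, c}, g {a, d}, g {b, c}, g {b, d}, g {c, d}]"
      by (simp only: list.map)
    have gK: "g p \<in> H" "p \<subseteq> g p" if "p \<in> {{a, b}, {a, c}, {a, d}, {b, c}, {b, d}, {c, d}}" for p
      using g[of p] K that by blast+
    have "has_berge_K4 H"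
      by (rule has_berge_K4I[OF dist dist']; rule gK; simp)
    then show False using free by (simp add: B_free_def)
  qed
  moreover have "card H \<le> card {T. T \<subseteq> V \<and> card T = 3 \<and> (\<forall>p. p \<subseteq> T \<and> card p = 2 \<longrightarrow> p \<in> R)} + card B"
  proof -
    have "S \<subseteq> {T. T \<subseteq> V \<and> card T = 3 \<and> (\<forall>p. p \<subseteq> T \<and> card p = 2 \<longrightarrow> p \<in> R)}"
      using S H by (auto simp: R_def P_def triple_system_def)
    then have "card S \<le> card {T. T \<subseteq> V \<and> card T = 3 \<and> (\<forall>p. p \<subseteq> T \<and> card p = 2 \<longrightarrow> p \<in> R)}"
      using V by (intro card_mono) auto
    moreover have "card B = card H - card S" using t(1) S finS by (simp add: B_def card_image card_Diff_subset)
    ultimately show ?thesis using card_mono[OF finH S] by linarith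
  qed
  ultimately show thesis using that[of R B] pairs RB by blast
qed

text \<open>Replacing every non-neighbour of a vertex of maximum weight by a copy of it cannot decrease
  the total weight; Mantel's theorem then bounds the weight of the resulting graph.\<close>

lemma red_blue_bound:
  assumes V: "finite V" "V \<noteq> {}" and pairs: "\<And>p. p \<in> R \<union> B \<Longrightarrow> p \<subseteq> V \<and> card p = 2"
    and disj: "R \<inter> B = {}" and free: "K4_free (R \<union> B)"
    and Tri: "Tri = {T. T \<subseteq> V \<and> card T = 3 \<and> (\<forall>p. p \<subseteq> T \<and> card p = 2 \<longrightarrow> p \<in> R)}"
  obtains p q c where "p + q + c = card V" "1 \<le> c"
    "card Tri + card B \<le> (c - 1) * (p * p div 4) + (p + q) * (p + q) div 4 + c * q"
proof -
  let ?G = "R \<union> B"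
  have finG: "finite ?G" using pairs V(1) by (meson finite_Pow_iff finite_subset Pow_iff subsetI)
  have finTri: "finite Tri" using V(1) by (simp add: Tri)
  define w where "w v = card {T \<in> Tri. v \<in> T} + card {p \<in> B. v \<in> p}" for v
  obtain u where u: "u \<in> V" "\<And>v. v \<in> V \<Longrightarrow> w v \<le> w u" using ex_maximizer[OF V, of w] by blast
  define Nr Nb where "Nr = {x \<in> V. {u, x} \<in> R}" and "Nb = {x \<in> V. {u, x} \<in> B}"
  define N where "N = Nr \<union> Nb"
  have N: "N = {x \<in> V. {u, x} \<in> ?G}" by (auto simp: N_def Nr_def Nb_def)
  have finN: "finite Nr" "finite Nb" "finite N" using V by (auto simp: N_def Nr_def Nb_def)
  have cN: "card N = card Nr + card Nb"
    unfolding N_def using disj finN by (intro card_Un_disjoint) (auto simp: Nr_def Nb_def)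
  have NV: "N \<subseteq> V" by (auto simp: N)
  have no_tri: False if "{u, x} \<in> ?G" "{u, y} \<in> ?G" "{u, z} \<in> ?G" "{x, y} \<in> ?G" "{y, z} \<in> ?G" "{x, z} \<in> ?G" for x y z
    using free that unfolding K4_free_def by (metis empty_subsetI insert_subset)
  \<comment> \<open>With \<open>u\<close> added, edges of \<open>E1\<close> become red triangles. A
    triangle in \<open>E1\<close> or in the union of \<open>E1\<close> and \<open>E2\<close> would
    extend by \<open>u\<close> to a K_4.\<close>
  define E1 E2 where "E1 = {p \<in> R. p \<subseteq> Nr}" and "E2 = {p \<in> B. p \<subseteq> N}"
  have E1: "card E1 \<le> card Nr * card Nr div 4"
  proof (rule mantel[OF finN(1)])
    fix x y z assume e: "{x, y} \<in> E1" "{y, z} \<in> E1" "{x, z} \<in> E1"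
    then have "x \<in> Nr" "y \<in> Nr" "z \<in> Nr" by (auto simp: E1_def)
    then show False using e by (intro no_tri[of x y z]) (auto simp: E1_def Nr_def)
  qed (use pairs in \<open>auto simp: E1_def\<close>)
  have E12: "card (E1 \<union> E2) \<le> card N * card N div 4"
  proof (rule mantel[OF finN(3)])
    fix x y z assume e: "{x, y} \<in> E1 \<union> E2" "{y, z} \<in> E1 \<union> E2" "{x, z} \<in> E1 \<union> E2"
    then have "x \<in> N" "y \<in> N" "z \<in> N" by (auto simp: E1_def E2_def N_def)
    then show False using e by (intro no_tri[of x y z]) (auto simp: E1_def E2_def N)
  next
    fix p assume "p \<in> E1 \<union> E2"
    then show "p \<subseteq> N \<and> card p = 2" using pairs[of p] by (auto simp: E1_def E2_def N_def)
  qed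
  have "finite E1" "finite E2" using finG by (auto simp: E1_def E2_def)
  then have cE: "card (E1 \<union> E2) = card E1 + card E2"
    using disj by (intro card_Un_disjoint) (auto simp: E1_def E2_def)
  have wu: "w u \<le> card E1 + card Nb"
  proof -
    have "{T \<in> Tri. u \<in> T} \<subseteq> insert u ` E1"
    proof
      fix T assume T: "T \<in> {T \<in> Tri. u \<in> T}"
      then have T': "T \<subseteq> V" "card T = 3" "u \<in> T" and R: "\<And>p. p \<subseteq> T \<Longrightarrow> card p = 2 \<Longrightarrow> p \<in> R"
        by (auto simp: Tri)
      have "T - {u} \<in> R" using T' by (intro R) auto
      moreover have "T - {u} \<subseteq> Nr"
      proof
        fix x assume x: "x \<in> T - {u}"
        then have "{u, x} \<in> R" using T' by (intro R) auto
        then show "x \<in> Nr" using x T' by (auto simp: Nr_def)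
      qed
      ultimately have "T - {u} \<in> E1" by (simp add: E1_def)
      moreover have "T = insert u (T - {u})" using T' by auto
      ultimately show "T \<in> insert u ` E1" by blast
    qed
    then have "card {T \<in> Tri. u \<in> T} \<le> card E1" using \<open>finite E1\<close> by (intro surj_card_le)
    moreover have "{p \<in> B. u \<in> p} \<subseteq> (\<lambda>x. {u, x}) ` Nb"
    proof
      fix p assume p: "p \<in> {p \<in> B. u \<in> p}"
      then have "card p = 2" "u \<in> p" using pairs by auto
      then obtain x where x: "p = {u, x}" by (rule pair_through)
      then have "x \<in> Nb" using p pairs[of p] by (auto simp: Nb_def)
      then show "p \<in> (\<lambda>x. {u, x}) ` Nb" using x by blast
    qed
    then have "card {p \<in> B. u \<in> p} \<le> card Nb" using finN by (intro surj_card_le)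
    ultimately show ?thesis by (simp add: w_def)
  qed
  let ?C = "V - N"
  \<comment> \<open>A red triangle inside \<open>N\<close> would form a K_4 with \<open>u\<close>,
    so every red triangle is charged to a non-neighbour.\<close>
  have "card Tri \<le> (\<Sum>v \<in> ?C. card {T \<in> Tri. v \<in> T})"
  proof (rule card_le_sum_incidence)
    fix T assume T: "T \<in> Tri"
    show "T \<inter> ?C \<noteq> {}"
    proof
      assume "T \<inter> ?C = {}"
      then have TN: "T \<subseteq> N" and R: "\<And>p. p \<subseteq> T \<Longrightarrow> card p = 2 \<Longrightarrow> p \<in> R" using T by (auto simp: Tri)
      obtain x y z where xyz: "T = {x, y, z}" "x \<noteq> y" "y \<noteq> z" "x \<noteq> z" using T by (auto simp: Tri card_3_iff)
      then show False using TN R[of "{x, y}"] R[of "{y, z}"] R[of "{x, z}"]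
        by (intro no_tri[of x y z]) (auto simp: N)
    qed
  qed (use V finTri in auto)
  \<comment> \<open>Blue edges inside \<open>N\<close> escape this charging and are kept apart as
    \<open>E2\<close>.\<close>
  moreover have "card B \<le> card E2 + (\<Sum>v \<in> ?C. card {p \<in> B. v \<in> p})"
  proof -
    have "card {p \<in> B. \<not> p \<subseteq> N} \<le> (\<Sum>v \<in> ?C. card {e \<in> {p \<in> B. \<not> p \<subseteq> N}. v \<in> e})"
      by (rule card_le_sum_incidence) (use V finG pairs in auto)
    also have "\<dots> \<le> (\<Sum>v \<in> ?C. card {p \<in> B. v \<in> p})"
      using finG by (intro sum_mono card_mono) auto
    finally have "card {p \<in> B. \<not> p \<subseteq> N} \<le> (\<Sum>v \<in> ?C. card {p \<in> B. v \<in> p})" .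
    moreover have "B = E2 \<union> {p \<in> B. \<not> p \<subseteq> N}" by (auto simp: E2_def)
    then have "card B \<le> card E2 + card {p \<in> B. \<not> p \<subseteq> N}" by (metis card_Un_le)
    ultimately show ?thesis by simp
  qed
  ultimately have "card Tri + card B \<le> card E2 + (\<Sum>v \<in> ?C. w v)" by (simp add: w_def sum.distrib)
  also have "(\<Sum>v \<in> ?C. w v) \<le> (\<Sum>v \<in> ?C. w u)" using u by (intro sum_mono) auto
  also have "\<dots> = card ?C * w u" by simp
  also have "card ?C * w u \<le> card ?C * (card E1 + card Nb)" using wu by simp
  finally have total: "card Tri + card B \<le> card E2 + card ?C * (card E1 + card Nb)" by simp
  \<comment> \<open>Here \<open>{u}\<close> is \<open>{u, u}\<close>: as it is no edge,
    \<open>u\<close> is its own non-neighbour and \<open>?C\<close> is nonempty.\<close>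
  have "{u} \<notin> ?G" using pairs[of "{u}"] by auto
  then have "u \<in> ?C" using u by (auto simp: N)
  then have C1: "1 \<le> card ?C" using V by (metis One_nat_def Suc_leI card_gt_0_iff empty_iff finite_Diff)
  then obtain d where d: "card ?C = d + 1" by (metis add.commute le_Suc_ex)
  \<comment> \<open>One copy of \<open>E1\<close> is joined with \<open>E2\<close> to use Mantel's
    theorem on all of \<open>N\<close>; the other copies use it on \<open>Nr\<close> alone.\<close>
  have "card E2 + card ?C * (card E1 + card Nb) = d * card E1 + card (E1 \<union> E2) + card ?C * card Nb"
    unfolding d cE by (simp add: algebra_simps)
  also have "\<dots> \<le> d * (card Nr * card Nr div 4) + card N * card N div 4 + card ?C * card Nb"
    using E1 E12 by (intro add_mono mult_le_mono2) auto
  finally have "card Tri + card B \<le> (card ?C - 1) * (card Nr * card Nr div 4) +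
      (card Nr + card Nb) * (card Nr + card Nb) div 4 + card ?C * card Nb"
    using total d unfolding cN by simp
  moreover have "card Nr + card Nb + card ?C = card V"
    using cN card_mono[OF V(1) NV] finN(3) NV by (simp add: card_Diff_subset)
  ultimately show thesis using that C1 by blast
qed

lemma nine_bound:
  assumes H: "triple_system V H" and V: "9 \<le> card V" and free: "B_free H"
  shows "card H \<le> f (card V)"
proof -
  have fin: "finite V" "V \<noteq> {}" using V by (auto intro: card_ge_0_finite)
  obtain R B where RB: "\<And>p. p \<in> R \<union> B \<Longrightarrow> p \<subseteq> V \<and> card p = 2" "R \<inter> B = {}" "K4_free (R \<union> B)"
    "card H \<le> card {T. T \<subseteq> V \<and> card T = 3 \<and> (\<forall>p. p \<subseteq> T \<and> card p = 2 \<longrightarrow> p \<in> R)} + card B"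
    using red_blue_decomposition[OF H fin(1) free] by blast
  obtain p q c where pqc: "p + q + c = card V" "1 \<le> c"
    "card {T. T \<subseteq> V \<and> card T = 3 \<and> (\<forall>p. p \<subseteq> T \<and> card p = 2 \<longrightarrow> p \<in> R)} + card B \<le>
      (c - 1) * (p * p div 4) + (p + q) * (p + q) div 4 + c * q"
    by (rule red_blue_bound[OF fin RB(1-3) refl]) auto
  show ?thesis using RB(4) pqc red_blue_bound_le_f[of p q c] V by simp
qed

subsection \<open>The extremal number\<close>

text \<open>Two points of a common triple lie in different parts, so the four core points would need
  four parts.\<close>

lemma complete_3partite_B_free:
  assumes "A \<inter> B = {}" "A \<inter> C = {}" "B \<inter> C = {}"
  shows "B_free (complete_3partite A B C)"
  unfolding B_free_def
proof
  assume "has_berge_K4 (complete_3partite A B C)"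
  then obtain v :: "nat \<Rightarrow> 'a" and e where inj: "inj_on v {1..4}"
    and e: "\<And>i j. 1 \<le> i \<Longrightarrow> i < j \<Longrightarrow> j \<le> 4 \<Longrightarrow> e i j \<in> complete_3partite A B C \<and> {v i, v j} \<subseteq> e i j"
    unfolding has_berge_K4_def by blast
  \<comment> \<open>The default value 2 stands for \<open>C\<close>; only points of triples are
    compared, and these lie in one of the parts.\<close>
  define part where "part x = (if x \<in> A then 0 else if x \<in> B then 1 else (2 :: nat))" for x
  have sep: "part x \<noteq> part y" if "t \<in> complete_3partite A B C" "{x, y} \<subseteq> t" "x \<noteq> y" for t x y
    using that assms by (auto simp: complete_3partite_def part_def)
  have "inj_on (\<lambda>i. part (v i)) {1..4}"
  proof (rule linorder_inj_onI)
    fix i j :: nat assume ij: "i < j" "i \<in> {1..4}" "j \<in> {1..4}"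
    then have "v i \<noteq> v j" using inj_onD[OF inj, of i j] by auto
    then show "part (v i) \<noteq> part (v j)" using e[of i j] sep[of "e i j" "v i" "v j"] ij by auto
  qed auto
  then have "card {1..4 :: nat} \<le> card {0, 1, 2 :: nat}"
    by (rule card_inj_on_le) (auto simp: part_def)
  then show False by simp
qed

lemma upper_bound:
  assumes H: "triple_system V H" and V: "6 \<le> card V" and free: "B_free H"
  shows "card H \<le> f (card V)"
proof -
  consider "card V = 6" | "card V = 7" | "card V = 8" | "9 \<le> card V" using V by linarith
  then show ?thesis
  proof cases
    case 1
    then show ?thesis using six_bound[OF H _ free] by (simp add: f_def)
  next
    case 2
    then show ?thesis using seven_bound[OF H _ free] by (simp add: f_def)
  next
    case 3
    then show ?thesis using eight_bound[OF H _ free] by (simp add: f_def)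
  next
    case 4
    then show ?thesis using nine_bound[OF H _ free] by simp
  qed
qed

lemma balanced_partition:
  obtains A B C :: "nat set" where "A \<union> B \<union> C = {0..<n}" "A \<inter> B = {}" "A \<inter> C = {}" "B \<inter> C = {}"
    "card A * card B * card C = f n"
proof
  let ?a = "n div 3" and ?b = "n div 3 + (n + 1) div 3"
  have n: "?b + (n + 2) div 3 = n" by presburger
  show "{0..<?a} \<union> {?a..<?b} \<union> {?b..<n} = {0..<n}" using n by auto
  show "{0..<?a} \<inter> {?a..<?b} = {}" "{0..<?a} \<inter> {?b..<n} = {}" "{?a..<?b} \<inter> {?b..<n} = {}" by auto
  have "n - ?b = (n + 2) div 3" using n by linarith
  then show "card {0..<?a} * card {?a..<?b} * card {?b..<n} = f n" by (simp add: f_def)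
qed

theorem theorem1:
  fixes n :: nat
  assumes "n \<ge> 6"
  shows "ex3_B n = f n \<and>
    (\<forall>A B C. A \<union> B \<union> C = {0..<n} \<and> A \<inter> B = {} \<and> A \<inter> C = {} \<and> B \<inter> C = {} \<and>
       card A = n div 3 \<and> card A \<le> card B \<and> card B \<le> card C \<and>
       card C = (n + 2) div 3
       \<longrightarrow> card (complete_3partite A B C) = f n)"
proof (intro conjI allI impI)
  let ?M = "{card H | H :: nat set set. triple_system {0..<n} H \<and> B_free H}"
  have le: "m \<le> f n" if "m \<in> ?M" for m
    using that upper_bound[of "{0..<n}"] assms by auto
  obtain A B C :: "nat set" where ABC: "A \<union> B \<union> C = {0..<n}" "A \<inter> B = {}" "A \<inter> C = {}" "B \<inter> C = {}"
    and prod: "card A * card B * card C = f n" using balanced_partition .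
  have fin: "finite A" "finite B" "finite C" using ABC(1) by (metis finite_Un finite_atLeastLessThan)+
  have "triple_system {0..<n} (complete_3partite A B C)"
    unfolding triple_system_def
  proof
    fix e assume "e \<in> complete_3partite A B C"
    then obtain a b c where abc: "e = {a, b, c}" "a \<in> A" "b \<in> B" "c \<in> C" by (auto simp: complete_3partite_def)
    then have "a \<noteq> b" "a \<noteq> c" "b \<noteq> c" "{a, b, c} \<subseteq> {0..<n}" using ABC by auto
    then show "e \<subseteq> {0..<n} \<and> card e = 3" using abc(1) by simp
  qed
  moreover have "B_free (complete_3partite A B C)" using complete_3partite_B_free[OF ABC(2-4)] .
  moreover have "card (complete_3partite A B C) = f n"
    using card_complete_3partite[OF fin ABC(2-4)] prod by simp
  ultimately have mem: "f n \<in> ?M" by (metis (mono_tags, lifting) mem_Collect_eq)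
  have "finite ?M" using le by (meson finite_nat_set_iff_bounded_le)
  then show "ex3_B n = f n" unfolding ex3_B_def using le mem by (intro Max_eqI)
next
  fix A B C :: "nat set"
  assume "A \<union> B \<union> C = {0..<n} \<and> A \<inter> B = {} \<and> A \<inter> C = {} \<and> B \<inter> C = {} \<and>
    card A = n div 3 \<and> card A \<le> card B \<and> card B \<le> card C \<and> card C = (n + 2) div 3"
  then have ABC: "A \<union> B \<union> C = {0..<n}" "A \<inter> B = {}" "A \<inter> C = {}" "B \<inter> C = {}"
    and cards: "card A = n div 3" "card C = (n + 2) div 3" by auto
  have fin: "finite A" "finite B" "finite C" using ABC(1) by (metis finite_Un finite_atLeastLessThan)+
  have "card (A \<union> B \<union> C) = card A + card B + card C"
    using ABC fin by (subst card_Un_disjoint; (subst card_Un_disjoint)?) auto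
  \<comment> \<open>The sizes of \<open>A\<close> and \<open>C\<close> together with the total
    number of points determine the size of \<open>B\<close>.\<close>
  then have "n = n div 3 + card B + (n + 2) div 3" unfolding ABC(1) cards by simp
  moreover have "n = n div 3 + (n + 1) div 3 + (n + 2) div 3" by presburger
  ultimately have "card B = (n + 1) div 3" by linarith
  then show "card (complete_3partite A B C) = f n"
    using card_complete_3partite[OF fin ABC(2-4)] cards by (simp add: f_def)
qed

end
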